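(* Let $f,g\in L^1(\mathbb{R}^N)$. Then for all $\boldsymbol{\omega}\in\mathbb{R}^N$, $$\mathcal{Q}_{\boldsymbol{\Lambda}}(f\oplus g)(\boldsymbol{\omega})=e^{-i\sum_{k=1}^N(\sqrt2-1)e_k\omega_k}\,(\mathcal{Q}_{\boldsymbol{\Lambda}}f)\Big(\frac{\boldsymbol{\omega}}{\sqrt2}\Big)\,(\mathcal{Q}_{\boldsymbol{\Lambda}}g)\Big(\frac{\boldsymbol{\omega}}{\sqrt2}\Big),$$ and, when $\mathcal{Q}_{\boldsymbol{\Lambda}}f,\mathcal{Q}_{\boldsymbol{\Lambda}}g\in L^1(\mathbb{R}^N)$ (so that $\ominus$ applies to them), $$\mathcal{Q}_{\boldsymbol{\Lambda}}\Big[e^{i\sum_{k=1}^N(\sqrt2-1)d_kx_k}\,f\Big(\frac{\boldsymbol{x}}{\sqrt2}\Big)g\Big(\frac{\boldsymbol{x}}{\sqrt2}\Big)\Big](\boldsymbol{\omega})=\big(\mathcal{Q}_{\boldsymbol{\Lambda}}f\ominus\mathcal{Q}_{\boldsymbol{\Lambda}}g\big)(\boldsymbol{\omega}).$$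
   Context: Let $N\ge 1$ and $\boldsymbol{\Lambda}=(\Lambda_1,\dots,\Lambda_N)$ with $\Lambda_k=(a_k,b_k,c_k,d_k,e_k)\in\mathbb{R}^5$ and $b_k\neq 0$ for $k=1,\dots,N$. The kernel is $$\mathcal{K}_{\boldsymbol{\Lambda}}(\boldsymbol{\omega},\boldsymbol{x})=\prod_{k=1}^N\sqrt{\tfrac{b_k}{2\pi i}}\;e^{i(a_kx_k^2+b_kx_k\omega_k+c_k\omega_k^2+d_kx_k+e_k\omega_k)},\qquad \boldsymbol{\omega},\boldsymbol{x}\in\mathbb{R}^N,$$ with principal square roots throughout. The multidimensional QPFT of $f\in L^1(\mathbb{R}^N)$ is $(\mathcal{Q}_{\boldsymbol{\Lambda}}f)(\boldsymbol{\omega})=\int_{\mathbb{R}^N}\mathcal{K}_{\boldsymbol{\Lambda}}(\boldsymbol{\omega},\boldsymbol{x})f(\boldsymbol{x})\,d\boldsymbol{x}$. For $f,g\in L^1(\mathbb{R}^N)$ define $$(f\oplus g)(\boldsymbol{x})=\Big(\prod_{k=1}^N\sqrt{\tfrac{b_k}{\pi i}}\Big)\int_{\mathbb{R}^N}f(\boldsymbol{\tau})\,g(\sqrt2\boldsymbol{x}-\boldsymbol{\tau})\,e^{\sum_{k=1}^N\left[2ia_k\left(\frac{x_k}{\sqrt2}-\tau_k\right)^2+i(\sqrt2-1)d_kx_k\right]}d\boldsymbol{\tau},$$ and the dual operation $$(f\ominus g)(\boldsymbol{x})=\Big(\prod_{k=1}^N\sqrt{\tfrac{i\,b_k}{\pi}}\Big)\int_{\mathbb{R}^N}f(\boldsymbol{\tau})\,g(\sqrt2\boldsymbol{x}-\boldsymbol{\tau})\,e^{-\sum_{k=1}^N\left[2ic_k\left(\frac{x_k}{\sqrt2}-\tau_k\right)^2+i(\sqrt2-1)e_kx_k\right]}d\boldsymbol{\tau}.$$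 *)

theory Defs
  imports "HOL-Analysis.Analysis"
begin

text \<open>
  The parameters \<open>\<Lambda>\<^sub>k = (a\<^sub>k, b\<^sub>k, c\<^sub>k, d\<^sub>k, e\<^sub>k)\<close> are stored columnwise, as five vectors
  \<open>a, b, c, d, e\<close> in \<open>\<real>\<^sup>N\<close> with \<open>N = CARD('n)\<close>.  Integrals are Lebesgue (Bochner) integrals, and
  \<open>f \<in> L\<^sup>1(\<real>\<^sup>N)\<close> is \<open>integrable lebesgue f\<close>, so \<open>f\<close> need only be Lebesgue measurable.
  All integrals are total: they are \<open>0\<close> where the integrand is not integrable.  In particular
  this fixes \<open>qp_conv\<close> on the null set of points where its defining integral may diverge.
\<close>

definition qp_kernel ::
  "real^'n \<Rightarrow> real^'n \<Rightarrow> real^'n \<Rightarrow> real^'n \<Rightarrow> real^'n \<Rightarrow> real^'n \<Rightarrow> real^'n \<Rightarrow> complex" where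
  "qp_kernel a b c d e \<omega> x =
     (\<Prod>k\<in>UNIV. csqrt (complex_of_real (b $ k) / (2 * complex_of_real pi * \<i>)) *
        exp (\<i> * complex_of_real
          (a $ k * (x $ k)\<^sup>2 + b $ k * x $ k * \<omega> $ k + c $ k * (\<omega> $ k)\<^sup>2
           + d $ k * x $ k + e $ k * \<omega> $ k)))"

definition qpft ::
  "real^'n \<Rightarrow> real^'n \<Rightarrow> real^'n \<Rightarrow> real^'n \<Rightarrow> real^'n \<Rightarrow>
   (real^'n \<Rightarrow> complex) \<Rightarrow> real^'n \<Rightarrow> complex" where
  "qpft a b c d e f \<omega> = (LINT x|lebesgue. qp_kernel a b c d e \<omega> x * f x)"

text \<open>The operation \<open>\<oplus>\<close>, which depends only on \<open>a, b, d\<close>.\<close>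

definition qp_conv ::
  "real^'n \<Rightarrow> real^'n \<Rightarrow> real^'n \<Rightarrow>
   (real^'n \<Rightarrow> complex) \<Rightarrow> (real^'n \<Rightarrow> complex) \<Rightarrow> real^'n \<Rightarrow> complex" where
  "qp_conv a b d f g x =
     (\<Prod>k\<in>UNIV. csqrt (complex_of_real (b $ k) / (complex_of_real pi * \<i>))) *
     (LINT \<tau>|lebesgue. f \<tau> * g (sqrt 2 *\<^sub>R x - \<tau>) *
        exp (\<Sum>k\<in>UNIV. 2 * \<i> * complex_of_real (a $ k * (x $ k / sqrt 2 - \<tau> $ k)\<^sup>2)
                      + \<i> * complex_of_real ((sqrt 2 - 1) * d $ k * x $ k)))"

text \<open>The dual operation \<open>\<ominus>\<close>, which depends only on \<open>b, c, e\<close>.\<close>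

definition qp_dual_conv ::
  "real^'n \<Rightarrow> real^'n \<Rightarrow> real^'n \<Rightarrow>
   (real^'n \<Rightarrow> complex) \<Rightarrow> (real^'n \<Rightarrow> complex) \<Rightarrow> real^'n \<Rightarrow> complex" where
  "qp_dual_conv b c e f g x =
     (\<Prod>k\<in>UNIV. csqrt (\<i> * complex_of_real (b $ k) / complex_of_real pi)) *
     (LINT \<tau>|lebesgue. f \<tau> * g (sqrt 2 *\<^sub>R x - \<tau>) *
        exp (- (\<Sum>k\<in>UNIV. 2 * \<i> * complex_of_real (c $ k * (x $ k / sqrt 2 - \<tau> $ k)\<^sup>2)
                      + \<i> * complex_of_real ((sqrt 2 - 1) * e $ k * x $ k))))"

end

theory Submission
  imports Defs "HOL-Probability.Characteristic_Functions"
begin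

text \<open>
  Up to quadratic phases, the QPFT is the ordinary Fourier transform.  Write
  \<open>\<chi>\<^sub>p\<^sub>,\<^sub>q(x) = cis (\<Sum>\<^sub>k p\<^sub>k x\<^sub>k\<^sup>2 + q\<^sub>k x\<^sub>k)\<close> for a chirp, \<open>D\<close> for the diagonal matrix with entries
  \<open>b\<^sub>k\<close> and \<open>K\<close> for the product of the square roots in the kernel.  The kernel factors, so that
  \<open>Q f (\<omega>) = K \<chi>\<^sub>c\<^sub>,\<^sub>e(\<omega>) \<F>(\<chi>\<^sub>a\<^sub>,\<^sub>d f)(D \<omega>)\<close> with
  \<open>\<F> h (\<xi>) = \<integral> cis (x \<bullet> \<xi>) h(x) dx\<close> (\<open>qpft_eq_fourier\<close>).  The weight in \<open>\<oplus>\<close> is chosen such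
  that it splits into chirps in \<open>\<tau>\<close>, in \<open>\<surd>2 x - \<tau>\<close> and in \<open>x\<close> (\<open>chirp_weight\<close>); therefore
  \<open>\<chi>\<^sub>a\<^sub>,\<^sub>d \<cdot> (f \<oplus> g)\<close> is a constant times the ordinary convolution of \<open>\<chi>\<^sub>a\<^sub>,\<^sub>d f\<close> and \<open>\<chi>\<^sub>a\<^sub>,\<^sub>d g\<close>,
  dilated by \<open>\<surd>2\<close>.  The first identity is then the classical convolution theorem
  (\<open>fourier_conv_fun\<close>).

  In the same way \<open>\<ominus>\<close>, applied to \<open>Q f\<close> and \<open>Q g\<close>, is an ordinary convolution of
  \<open>\<F>(\<chi>\<^sub>a\<^sub>,\<^sub>d f) \<circ> D\<close> and \<open>\<F>(\<chi>\<^sub>a\<^sub>,\<^sub>d g) \<circ> D\<close>, so that the second identity amounts to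
  \<open>\<F> f \<star> \<F> g = (2\<pi>)\<^sup>N \<F>(f g)\<close> (\<open>conv_fun_fourier\<close>).  By Fubini, this follows from the
  Fourier inversion formula almost everywhere for integrable functions with integrable
  transform (\<open>fourier_inversion\<close>); inversion also shows that such a function is essentially
  bounded, which makes \<open>f g\<close> integrable.

  The inversion formula is proved on an arbitrary Euclidean space.  A Gaussian factor of width
  \<open>1/\<epsilon>\<close> inserted in the inversion integral turns it into the average of \<open>f(x + \<epsilon> z)\<close> against a
  Gaussian in \<open>z\<close>.  After integration over a box in \<open>x\<close>, the limit \<open>\<epsilon> \<rightarrow> 0\<close> needs only dominated
  convergence, because box integrals of an \<open>L\<^sup>1\<close> function depend continuously on translations.
  Hence both sides of the formula have the same integral over every box, and Lebesgue's
  differentiation theorem gives equality almost everywhere.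

  The functions in the theorem are only Lebesgue measurable, whereas Fubini's theorem is
  applied on products of Borel spaces; they are replaced throughout by Borel functions equal to
  them almost everywhere, which changes none of the integrals.
\<close>

section \<open>Affine changes of variables\<close>

text \<open>
  The three transfer statements all come from writing Lebesgue measure as a multiple of its image
  under the affine map.
\<close>

lemma
  fixes c :: "'a::euclidean_space \<Rightarrow> real" and t :: 'a
    and f :: "'a \<Rightarrow> 'b::{banach, second_countable_topology}"
  assumes c: "\<And>j. j \<in> Basis \<Longrightarrow> c j \<noteq> 0"
  shows integrable_lborel_diagonal:
      "integrable lborel f \<Longrightarrow>
        integrable lborel (\<lambda>x. f (t + (\<Sum>j\<in>Basis. (c j * (x \<bullet> j)) *\<^sub>R j)))"
    and integral_lborel_diagonal:
      "f \<in> borel_measurable borel \<Longrightarrow>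
        integral\<^sup>L lborel f = (\<Prod>j\<in>Basis. \<bar>c j\<bar>) *\<^sub>R
          (LINT x|lborel. f (t + (\<Sum>j\<in>Basis. (c j * (x \<bullet> j)) *\<^sub>R j)))"
    and AE_lborel_diagonal:
      "AE x in lborel. P x \<Longrightarrow>
        AE x in lborel. P (t + (\<Sum>j\<in>Basis. (c j * (x \<bullet> j)) *\<^sub>R j))"
proof -
  define T where "T = (\<lambda>x. t + (\<Sum>j\<in>Basis. (c j * (x \<bullet> j)) *\<^sub>R j))"
  define p where "p = (\<Prod>j\<in>Basis. \<bar>c j\<bar>)"
  have p: "p > 0" using c by (auto simp: p_def intro!: prod_pos)
  have T[measurable]: "T \<in> lborel \<rightarrow>\<^sub>M borel" by (simp add: T_def)
  have eq: "lborel = density (distr lborel borel T) (\<lambda>_. ennreal p)"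
    using lborel_affine_euclidean[of c t] c by (simp add: T_def[abs_def] p_def)
  show "integrable lborel (\<lambda>x. f (t + (\<Sum>j\<in>Basis. (c j * (x \<bullet> j)) *\<^sub>R j)))"
    if "integrable lborel f"
  proof -
    have m[measurable]: "f \<in> borel_measurable borel" using that by simp
    have "integrable (density (distr lborel borel T) (\<lambda>_. ennreal p)) f"
      using that unfolding eq[symmetric] .
    then have "integrable lborel (\<lambda>x. p *\<^sub>R f (T x))"
      using p by (simp add: integrable_density integrable_distr_eq)
    then have "integrable lborel (\<lambda>x. inverse p *\<^sub>R (p *\<^sub>R f (T x)))"
      by (rule integrable_scaleR_right)
    then show ?thesis using p by (simp add: T_def)
  qed
  show "integral\<^sup>L lborel f = (\<Prod>j\<in>Basis. \<bar>c j\<bar>) *\<^sub>R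
          (LINT x|lborel. f (t + (\<Sum>j\<in>Basis. (c j * (x \<bullet> j)) *\<^sub>R j)))"
    if m[measurable]: "f \<in> borel_measurable borel"
  proof -
    have "integral\<^sup>L lborel f = integral\<^sup>L (density (distr lborel borel T) (\<lambda>_. ennreal p)) f"
      unfolding eq[symmetric] ..
    also have "\<dots> = p *\<^sub>R (LINT x|lborel. f (T x))"
      using p by (simp add: integral_density integral_distr)
    finally show ?thesis by (simp add: T_def p_def)
  qed
  show "AE x in lborel. P (t + (\<Sum>j\<in>Basis. (c j * (x \<bullet> j)) *\<^sub>R j))"
    if "AE x in lborel. P x"
  proof -
    have "AE x in density (distr lborel borel T) (\<lambda>_. ennreal p). P x"
      using that unfolding eq[symmetric] .
    then have "AE x in distr lborel borel T. P x"
      using p by (simp add: AE_density)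
    from AE_distrD[OF T this] show ?thesis by (simp add: T_def)
  qed
qed

lemma
  fixes c :: real and t :: "'a::euclidean_space"
    and f :: "'a \<Rightarrow> 'b::{banach, second_countable_topology}"
  assumes c: "c \<noteq> 0"
  shows integrable_lborel_affine:
      "integrable lborel f \<Longrightarrow> integrable lborel (\<lambda>x. f (t + c *\<^sub>R x))"
    and integral_lborel_affine:
      "f \<in> borel_measurable borel \<Longrightarrow>
        integral\<^sup>L lborel f = \<bar>c\<bar> ^ DIM('a) *\<^sub>R (LINT x|lborel. f (t + c *\<^sub>R x))"
    and AE_lborel_affine:
      "AE x in lborel. P x \<Longrightarrow> AE x in lborel. P (t + c *\<^sub>R x)"
proof -
  have "(\<Sum>j\<in>Basis. (c * (x \<bullet> j)) *\<^sub>R j) = c *\<^sub>R x" for x :: 'a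
    unfolding scaleR_scaleR[symmetric] scaleR_sum_right[symmetric] euclidean_representation ..
  then show "integrable lborel f \<Longrightarrow> integrable lborel (\<lambda>x. f (t + c *\<^sub>R x))"
    "f \<in> borel_measurable borel \<Longrightarrow>
        integral\<^sup>L lborel f = \<bar>c\<bar> ^ DIM('a) *\<^sub>R (LINT x|lborel. f (t + c *\<^sub>R x))"
    "AE x in lborel. P x \<Longrightarrow> AE x in lborel. P (t + c *\<^sub>R x)"
    using integrable_lborel_diagonal[of "\<lambda>_. c" f t] integral_lborel_diagonal[of "\<lambda>_. c" f t]
      AE_lborel_diagonal[of "\<lambda>_. c" P t] c by simp_all
qed

section \<open>The Fourier transform and convolution of integrable functions\<close>

text \<open>
  The phase has a positive sign and there is no normalising factor, as in the kernel of the QPFT;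
  the inversion formula therefore carries the factor \<open>(2\<pi>)\<^sup>N\<close>.
\<close>

definition fourier :: "('a::euclidean_space \<Rightarrow> complex) \<Rightarrow> 'a \<Rightarrow> complex" where
  "fourier f \<xi> = (LINT x|lborel. cis (x \<bullet> \<xi>) * f x)"

definition conv_fun ::
  "('a::euclidean_space \<Rightarrow> complex) \<Rightarrow> ('a \<Rightarrow> complex) \<Rightarrow> 'a \<Rightarrow> complex" where
  "conv_fun f g x = (LINT \<tau>|lborel. f \<tau> * g (x - \<tau>))"

lemma cis_measurable [measurable]: "cis \<in> borel_measurable borel"
  by (intro borel_measurable_continuous_onI continuous_intros)

lemma integrable_unimodular_mult:
  fixes h f :: "'a \<Rightarrow> complex"
  assumes "integrable M f" "h \<in> borel_measurable M" "\<And>x. norm (h x) \<le> 1"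
  shows "integrable M (\<lambda>x. h x * f x)"
  using assms by (intro Bochner_Integration.integrable_bound[OF assms(1)])
    (auto simp: norm_mult intro!: mult_left_le_one_le)

text \<open>
  The shape in which Fubini's theorem serves for exchanging a Fourier integral with another
  integral: two integrable functions, coupled by a bounded kernel such as a phase.
\<close>

lemma integrable_mult_prod:
  fixes f g :: "'a::euclidean_space \<Rightarrow> complex"
  assumes f: "integrable lborel f" and g: "integrable lborel g"
    and k[measurable]: "k \<in> borel_measurable (borel \<Otimes>\<^sub>M borel)" and k1: "\<And>z. norm (k z) \<le> 1"
  shows "integrable (lborel \<Otimes>\<^sub>M lborel) (\<lambda>(x, y). k (x, y) * (f x * g y))"
proof -
  have [measurable]: "f \<in> borel_measurable borel" "g \<in> borel_measurable borel"
    using f g by simp_all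
  have "integrable (lborel \<Otimes>\<^sub>M lborel) (\<lambda>(x, y). f x * g y)"
  proof (rule lborel_pair.Fubini_integrable)
    show "(\<lambda>(x, y). f x * g y) \<in> borel_measurable (lborel \<Otimes>\<^sub>M lborel)" by measurable
    show "integrable lborel (\<lambda>x. LINT y|lborel. norm (case (x, y) of (x, y) \<Rightarrow> f x * g y))"
      using f by (simp add: norm_mult)
    show "AE x in lborel. integrable lborel (\<lambda>y. case (x, y) of (x, y) \<Rightarrow> f x * g y)"
      using g by simp
  qed
  then have "integrable (lborel \<Otimes>\<^sub>M lborel) (\<lambda>z. k z * (case z of (x, y) \<Rightarrow> f x * g y))"
    by (rule integrable_unimodular_mult) (use k1 in auto)
  then show ?thesis by (simp add: case_prod_beta')
qed

lemma Fubini_mult: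
  fixes f g :: "'a::euclidean_space \<Rightarrow> complex"
  assumes f: "integrable lborel f" and g: "integrable lborel g"
    and k: "k \<in> borel_measurable (borel \<Otimes>\<^sub>M borel)" and k1: "\<And>z. norm (k z) \<le> 1"
  shows "(LINT x|lborel. f x * (LINT y|lborel. k (x, y) * g y)) =
         (LINT y|lborel. g y * (LINT x|lborel. k (x, y) * f x))"
proof -
  have "(LINT x|lborel. f x * (LINT y|lborel. k (x, y) * g y)) =
        (LINT x|lborel. LINT y|lborel. k (x, y) * (f x * g y))"
    by (simp add: mult.left_commute flip: integral_mult_right_zero)
  also have "\<dots> = (LINT y|lborel. LINT x|lborel. k (x, y) * (f x * g y))"
    using integrable_mult_prod[OF assms]
    by (intro lborel_pair.Fubini_integral[symmetric]) simp
  also have "\<dots> = (LINT y|lborel. g y * (LINT x|lborel. k (x, y) * f x))"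
    by (simp add: mult_ac flip: integral_mult_right_zero)
  finally show ?thesis .
qed

lemma fourier_measurable [measurable]:
  assumes [measurable]: "f \<in> borel_measurable borel"
  shows "fourier f \<in> borel_measurable borel"
  unfolding fourier_def by measurable

lemma fourier_multiplication_formula:
  assumes "integrable lborel f" "integrable lborel g"
  shows "(LINT \<xi>|lborel. g \<xi> * fourier f \<xi>) = (LINT x|lborel. f x * fourier g x)"
  using Fubini_mult[OF assms, of "\<lambda>(x, y). cis (x \<bullet> y)"]
  by (auto simp: fourier_def inner_commute split_beta)

text \<open>
  Both facts rest on the integrability of \<open>f \<tau> * g (x - \<tau>)\<close> in \<open>(\<tau>, x)\<close>, whose inner integral over
  \<open>x\<close> is a translation.  With the order of integration exchanged, translating \<open>g\<close> by \<open>\<tau>\<close>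
  multiplies its transform by \<open>cis (\<tau> \<bullet> \<xi>)\<close>.
\<close>

lemma
  assumes f: "integrable lborel f" and g: "integrable lborel g"
  shows integrable_conv_fun: "integrable lborel (conv_fun f g)"
    and fourier_conv_fun: "fourier (conv_fun f g) \<xi> = fourier f \<xi> * fourier g \<xi>"
proof -
  have [measurable]: "f \<in> borel_measurable borel" "g \<in> borel_measurable borel"
    using f g by simp_all
  have shift: "integrable lborel (\<lambda>x. g (x - \<tau>))" "(LINT x|lborel. norm (g (x - \<tau>))) = (LINT x|lborel. norm (g x))"
     for \<tau>
    using integrable_lborel_affine[of 1 g "-\<tau>"] integral_lborel_affine[of 1 "\<lambda>x. norm (g x)" "-\<tau>"] g
    by simp_all
  have int: "integrable (lborel \<Otimes>\<^sub>M lborel) (\<lambda>(\<tau>, x). f \<tau> * g (x - \<tau>))"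
  proof (rule lborel_pair.Fubini_integrable)
    show "(\<lambda>(\<tau>, x). f \<tau> * g (x - \<tau>)) \<in> borel_measurable (lborel \<Otimes>\<^sub>M lborel)" by measurable
    show "integrable lborel (\<lambda>\<tau>. LINT x|lborel. norm (case (\<tau>, x) of (\<tau>, x) \<Rightarrow> f \<tau> * g (x - \<tau>)))"
      using f by (simp add: norm_mult shift)
    show "AE \<tau> in lborel. integrable lborel (\<lambda>x. case (\<tau>, x) of (\<tau>, x) \<Rightarrow> f \<tau> * g (x - \<tau>))"
      by (simp add: shift)
  qed
  then show "integrable lborel (conv_fun f g)"
    unfolding conv_fun_def[abs_def] using lborel_pair.integrable_snd by blast
  have int': "integrable (lborel \<Otimes>\<^sub>M lborel) (\<lambda>(\<tau>, x). cis (x \<bullet> \<xi>) * (f \<tau> * g (x - \<tau>)))"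
    using integrable_unimodular_mult[OF int, of "\<lambda>(\<tau>, x). cis (x \<bullet> \<xi>)"]
    by (simp add: case_prod_beta')
  have *: "(LINT x|lborel. cis (x \<bullet> \<xi>) * g (x - \<tau>)) = cis (\<tau> \<bullet> \<xi>) * fourier g \<xi>" for \<tau>
  proof -
    have "(LINT x|lborel. cis (x \<bullet> \<xi>) * g (x - \<tau>)) =
          (LINT x|lborel. cis ((\<tau> + 1 *\<^sub>R x) \<bullet> \<xi>) * g ((\<tau> + 1 *\<^sub>R x) - \<tau>))"
      by (subst integral_lborel_affine[of 1 _ \<tau>]) simp_all
    also have "\<dots> = (LINT x|lborel. cis (\<tau> \<bullet> \<xi>) * (cis (x \<bullet> \<xi>) * g x))"
      by (simp add: inner_add_left flip: cis_mult mult.assoc)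
    finally show ?thesis by (simp add: fourier_def)
  qed
  have "fourier (conv_fun f g) \<xi> = (LINT x|lborel. LINT \<tau>|lborel. cis (x \<bullet> \<xi>) * (f \<tau> * g (x - \<tau>)))"
    by (simp add: fourier_def conv_fun_def)
  also have "\<dots> = (LINT \<tau>|lborel. LINT x|lborel. cis (x \<bullet> \<xi>) * (f \<tau> * g (x - \<tau>)))"
    by (rule lborel_pair.Fubini_integral) (use int' in simp)
  also have "\<dots> = (LINT \<tau>|lborel. f \<tau> * (LINT x|lborel. cis (x \<bullet> \<xi>) * g (x - \<tau>)))"
    by (simp add: mult.left_commute flip: integral_mult_right_zero)
  also have "\<dots> = (LINT \<tau>|lborel. (cis (\<tau> \<bullet> \<xi>) * f \<tau>) * fourier g \<xi>)"
    by (simp add: * mult_ac)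
  also have "\<dots> = fourier f \<xi> * fourier g \<xi>"
    by (simp only: integral_mult_left_zero fourier_def)
  finally show "fourier (conv_fun f g) \<xi> = fourier f \<xi> * fourier g \<xi>" .
qed

section \<open>Gaussians\<close>

lemma
  fixes f :: "'a::euclidean_space \<Rightarrow> real \<Rightarrow> complex"
  assumes f: "\<And>b. b \<in> Basis \<Longrightarrow> integrable lborel (f b)"
  shows integrable_lborel_Basis_prod: "integrable lborel (\<lambda>x. \<Prod>b\<in>Basis. f b (x \<bullet> b))"
    and integral_lborel_Basis_prod:
      "(LINT x|lborel. (\<Prod>b\<in>Basis. f b (x \<bullet> b))) = (\<Prod>b\<in>Basis. LINT x|lborel. f b x)"
proof -
  interpret product_sigma_finite "\<lambda>_::'a. lborel :: real measure" ..
  have [measurable]: "(\<lambda>x::'a. \<Prod>b\<in>Basis. f b (x \<bullet> b)) \<in> borel_measurable borel"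
  proof (rule borel_measurable_prod)
    fix b :: 'a assume "b \<in> Basis"
    then have [measurable]: "f b \<in> borel_measurable borel" using f by simp
    show "(\<lambda>x. f b (x \<bullet> b)) \<in> borel_measurable borel" by measurable
  qed
  have eq: "(\<Prod>b\<in>Basis. f b ((\<Sum>j\<in>Basis. y j *\<^sub>R j) \<bullet> b)) = (\<Prod>b\<in>Basis. f b (y b))" for y :: "'a \<Rightarrow> real"
    by (intro prod.cong) simp_all
  show "integrable lborel (\<lambda>x. \<Prod>b\<in>Basis. f b (x \<bullet> b))"
    unfolding lborel_eq[where 'a='a] using product_integrable_prod[OF finite_Basis f]
    by (simp add: integrable_distr_eq eq)
  show "(LINT x|lborel. (\<Prod>b\<in>Basis. f b (x \<bullet> b))) = (\<Prod>b\<in>Basis. LINT x|lborel. f b x)"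
    unfolding lborel_eq[where 'a='a] using product_integral_prod[OF finite_Basis f]
    by (simp add: integral_distr eq)
qed

definition gaussian :: "'a::euclidean_space \<Rightarrow> real" where
  "gaussian x = exp (- (norm x)\<^sup>2 / 2)"

lemma gaussian_measurable [measurable]: "gaussian \<in> borel_measurable borel"
  unfolding gaussian_def[abs_def] by measurable

lemma gaussian_bounds: "0 < gaussian x" "gaussian x \<le> 1"
  by (simp_all add: gaussian_def)

lemma gaussian_prod: "gaussian x = (\<Prod>b\<in>Basis. exp (- (x \<bullet> b)\<^sup>2 / 2))"
proof -
  have "(norm x)\<^sup>2 = (\<Sum>b\<in>Basis. (x \<bullet> b)\<^sup>2)"
    unfolding power2_norm_eq_inner by (subst euclidean_inner) (simp add: power2_eq_square)
  then show ?thesis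
    by (simp add: gaussian_def exp_sum[symmetric] sum_negf sum_divide_distrib)
qed

text \<open>
  In one dimension the Gaussian integral is the characteristic function of the standard normal
  distribution without its normalisation.
\<close>

lemma
  shows integrable_gaussian_real: "integrable lborel (\<lambda>x::real. exp (- x\<^sup>2 / 2))"
    and fourier_gaussian_real:
      "(LINT x|lborel. cis (x * t) * complex_of_real (exp (- x\<^sup>2 / 2))) = sqrt (2 * pi) * exp (- t\<^sup>2 / 2)"
proof -
  have e: "exp (- x\<^sup>2 / 2) = sqrt (2 * pi) * std_normal_density x" for x :: real
    by (simp add: std_normal_density_def)
  show "integrable lborel (\<lambda>x::real. exp (- x\<^sup>2 / 2))"
    unfolding e using integrable_normal_density by simp
  have iexp_cis: "iexp (t * x) = cis (x * t)" for x
    unfolding cis_conv_exp by (simp only: mult.commute)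
  have "char std_normal_distribution t = (LINT x|lborel. std_normal_density x *\<^sub>R cis (x * t))"
    unfolding char_def iexp_cis by (rule integral_density) simp_all
  then have t: "(LINT x|lborel. std_normal_density x *\<^sub>R cis (x * t)) = complex_of_real (exp (- t\<^sup>2 / 2))"
    unfolding char_std_normal_distribution by (rule sym)
  have "(LINT x|lborel. cis (x * t) * complex_of_real (exp (- x\<^sup>2 / 2))) =
        (LINT x|lborel. sqrt (2 * pi) * (std_normal_density x *\<^sub>R cis (x * t)))"
    unfolding e scaleR_conv_of_real of_real_mult
    by (intro Bochner_Integration.integral_cong refl) (simp only: mult_ac)
  also have "\<dots> = sqrt (2 * pi) * exp (- t\<^sup>2 / 2)"
    unfolding integral_mult_right_zero t of_real_mult ..
  finally show "(LINT x|lborel. cis (x * t) * complex_of_real (exp (- x\<^sup>2 / 2))) = sqrt (2 * pi) * exp (- t\<^sup>2 / 2)" .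
qed

lemma
  shows integrable_gaussian: "integrable lborel (\<lambda>x::'a::euclidean_space. complex_of_real (gaussian x))"
    and fourier_gaussian:
      "fourier (\<lambda>x. complex_of_real (gaussian x)) (\<xi>::'a) = sqrt (2 * pi) ^ DIM('a) * gaussian \<xi>"
proof -
  have c: "cis (x \<bullet> \<xi>) = (\<Prod>b\<in>Basis. cis ((x \<bullet> b) * (\<xi> \<bullet> b)))" for x :: 'a
    unfolding euclidean_inner[of x \<xi>] cis_conv_exp of_real_sum sum_distrib_left by (rule exp_sum) simp
  have i: "integrable lborel (\<lambda>x. complex_of_real (exp (- x\<^sup>2 / 2)))"
    using integrable_gaussian_real by (simp only: complex_of_real_integrable_eq)
  show "integrable lborel (\<lambda>x::'a. complex_of_real (gaussian x))"
    using integrable_lborel_Basis_prod[of "\<lambda>_ x. complex_of_real (exp (- x\<^sup>2 / 2))"] i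
    by (simp add: gaussian_prod)
  have "fourier (\<lambda>x. complex_of_real (gaussian x)) \<xi> =
     (LINT x|lborel. (\<Prod>b\<in>Basis. cis ((x \<bullet> b) * (\<xi> \<bullet> b)) * complex_of_real (exp (- (x \<bullet> b)\<^sup>2 / 2))))"
    unfolding fourier_def c gaussian_prod of_real_prod prod.distrib ..
  also have "\<dots> = (\<Prod>b\<in>Basis. LINT x|lborel. cis (x * (\<xi> \<bullet> b)) * complex_of_real (exp (- x\<^sup>2 / 2)))"
    by (intro integral_lborel_Basis_prod[of "\<lambda>b x. cis (x * (\<xi> \<bullet> b)) * complex_of_real (exp (- x\<^sup>2 / 2))"]
        integrable_unimodular_mult i) simp_all
  also have "\<dots> = sqrt (2 * pi) ^ DIM('a) * gaussian \<xi>"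
    unfolding fourier_gaussian_real gaussian_prod of_real_mult of_real_prod prod.distrib prod_constant of_real_power ..
  finally show "fourier (\<lambda>x. complex_of_real (gaussian x)) \<xi> = sqrt (2 * pi) ^ DIM('a) * gaussian \<xi>" .
qed

text \<open>
  The inversion integral with a Gaussian cutoff: the multiplication formula moves the transform
  from \<open>f\<close> to the modulated Gaussian, where it is again a Gaussian, centred at \<open>y\<close> and of
  width \<open>\<epsilon>\<close>.
\<close>

lemma fourier_gaussian_regularized:
  fixes f :: "'a::euclidean_space \<Rightarrow> complex"
  assumes f: "integrable lborel f" and \<epsilon>: "\<epsilon> > 0"
  shows "(LINT \<xi>|lborel. fourier f \<xi> * cis (- (y \<bullet> \<xi>)) * gaussian (\<epsilon> *\<^sub>R \<xi>)) =
         sqrt (2 * pi) ^ DIM('a) * (LINT z|lborel. gaussian z * f (y + \<epsilon> *\<^sub>R z))"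
proof -
  have [measurable]: "f \<in> borel_measurable borel" using f by simp
  define g where "g \<xi> = cis (- (y \<bullet> \<xi>)) * gaussian (\<epsilon> *\<^sub>R \<xi>)" for \<xi>
  have g: "integrable lborel g"
    unfolding g_def using integrable_lborel_affine[OF _ integrable_gaussian, of \<epsilon> 0] \<epsilon>
    by (intro integrable_unimodular_mult) simp_all
  have [measurable]: "g \<in> borel_measurable borel" using g by simp
  have fg: "\<epsilon> ^ DIM('a) * fourier g (y + \<epsilon> *\<^sub>R z) = sqrt (2 * pi) ^ DIM('a) * gaussian z" for z
  proof -
    define h where "h x = cis (x \<bullet> z) * complex_of_real (gaussian x)" for x
    have "fourier g (y + \<epsilon> *\<^sub>R z) = (LINT x|lborel. h (\<epsilon> *\<^sub>R x))"
      unfolding fourier_def g_def h_def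
      by (intro Bochner_Integration.integral_cong refl)
        (simp add: cis_mult inner_add_right inner_commute flip: mult.assoc)
    moreover have "integral\<^sup>L lborel h = \<epsilon> ^ DIM('a) *\<^sub>R (LINT x|lborel. h (\<epsilon> *\<^sub>R x))"
      using integral_lborel_affine[of \<epsilon> h 0] \<epsilon> by (simp add: h_def[abs_def])
    moreover have "integral\<^sup>L lborel h = sqrt (2 * pi) ^ DIM('a) * gaussian z"
      using fourier_gaussian[of z] by (simp add: fourier_def h_def[abs_def])
    ultimately show ?thesis by (simp add: scaleR_conv_of_real)
  qed
  have "(LINT \<xi>|lborel. fourier f \<xi> * cis (- (y \<bullet> \<xi>)) * gaussian (\<epsilon> *\<^sub>R \<xi>)) =
        (LINT \<xi>|lborel. g \<xi> * fourier f \<xi>)"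
    unfolding g_def by (intro Bochner_Integration.integral_cong refl) (simp add: mult.commute)
  also have "\<dots> = (LINT x|lborel. f x * fourier g x)"
    by (rule fourier_multiplication_formula[OF f g])
  also have "\<dots> = \<epsilon> ^ DIM('a) *\<^sub>R (LINT z|lborel. f (y + \<epsilon> *\<^sub>R z) * fourier g (y + \<epsilon> *\<^sub>R z))"
    using integral_lborel_affine[of \<epsilon> "\<lambda>x. f x * fourier g x" y] \<epsilon> by simp
  also have "\<dots> = \<epsilon> ^ DIM('a) * (LINT z|lborel. f (y + \<epsilon> *\<^sub>R z) * fourier g (y + \<epsilon> *\<^sub>R z))"
    by (simp add: scaleR_conv_of_real)
  also have "\<dots> = (LINT z|lborel. f (y + \<epsilon> *\<^sub>R z) * (\<epsilon> ^ DIM('a) * fourier g (y + \<epsilon> *\<^sub>R z)))"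
    by (subst integral_mult_right_zero[symmetric]) (simp only: mult.left_commute)
  also have "\<dots> = (LINT z|lborel. complex_of_real (sqrt (2 * pi) ^ DIM('a)) * (gaussian z * f (y + \<epsilon> *\<^sub>R z)))"
    unfolding fg of_real_mult by (intro Bochner_Integration.integral_cong refl) (simp only: mult_ac)
  finally show ?thesis by (simp only: integral_mult_right_zero of_real_power)
qed

section \<open>Fourier inversion\<close>

text \<open>
  Translating \<open>f\<close> is the same as translating the indicator of the box, and the translated indicators
  converge at every point off the boundary of the box, hence almost everywhere.
\<close>

lemma box_integral_translation:
  fixes f :: "'a::euclidean_space \<Rightarrow> complex"
  assumes f: "integrable lborel f" and v: "v \<longlonglongrightarrow> 0"
  shows "(\<lambda>n. LINT y:cbox a b|lborel. f (y + v n)) \<longlonglongrightarrow> (LINT y:cbox a b|lborel. f y)"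
proof -
  have [measurable]: "f \<in> borel_measurable borel" using f by simp
  have "(LINT y:cbox a b|lborel. f (y + v n)) = (LINT x|lborel. indicator (cbox a b) (x - v n) *\<^sub>R f x)" for n
    using integral_lborel_affine[of 1 "\<lambda>x. indicator (cbox a b) (x - v n) *\<^sub>R f x" "v n"]
    by (simp add: set_lebesgue_integral_def add.commute)
  moreover have "(\<lambda>n. LINT x|lborel. indicator (cbox a b) (x - v n) *\<^sub>R f x) \<longlonglongrightarrow>
     (LINT x|lborel. indicator (cbox a b) x *\<^sub>R f x)"
  proof (rule integral_dominated_convergence[where w="\<lambda>x. norm (f x)"])
    have "AE x in lborel. x \<notin> cbox a b - box a b"
      using negligible_frontier_interval[of a b] by (intro AE_not_in)
         (simp add: negligible_iff_null_sets null_sets_completion_iff)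
    then show "AE x in lborel. (\<lambda>n. indicator (cbox a b) (x - v n) *\<^sub>R f x) \<longlonglongrightarrow>
         indicator (cbox a b) x *\<^sub>R f x"
    proof eventually_elim
      case (elim x)
      have lim: "(\<lambda>n. x - v n) \<longlonglongrightarrow> x" using tendsto_diff[OF tendsto_const v, of x] by simp
      have "\<forall>\<^sub>F n in sequentially. indicator (cbox a b) (x - v n) = (indicator (cbox a b) x :: real)"
      proof (cases "x \<in> box a b")
        case True
        have "\<forall>\<^sub>F n in sequentially. x - v n \<in> box a b"
          using topological_tendstoD[OF lim open_box True] .
        then show ?thesis
          by eventually_elim (use True box_subset_cbox[of a b] in \<open>auto simp: indicator_def\<close>)
      next
        case False
        then have "x \<in> - cbox a b" using elim by auto
        then have "\<forall>\<^sub>F n in sequentially. x - v n \<in> - cbox a b"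
          using topological_tendstoD[OF lim open_Compl[OF closed_cbox]] by blast
        then show ?thesis
          by eventually_elim (use \<open>x \<in> - cbox a b\<close> in \<open>auto simp: indicator_def\<close>)
      qed
      then have "\<forall>\<^sub>F n in sequentially. indicator (cbox a b) x *\<^sub>R f x = indicator (cbox a b) (x - v n) *\<^sub>R f x"
        by eventually_elim simp
      then show ?case by (rule Lim_transform_eventually[OF tendsto_const])
    qed
  qed (use f in \<open>auto simp: indicator_def\<close>)
  ultimately show ?thesis by (simp add: set_lebesgue_integral_def)
qed

text \<open>
  By Lebesgue's differentiation theorem, almost every value of \<open>h\<close> is the limit of averages of \<open>h\<close>
  over shrinking cubes, and these averages vanish.
\<close>

lemma AE_eq_0_if_box_integrals_eq_0:
  fixes h :: "'a::euclidean_space \<Rightarrow> complex"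
  assumes int: "\<And>a b. set_integrable lborel (cbox a b) h"
    and zero: "\<And>a b. (LINT y:cbox a b|lborel. h y) = 0"
  shows "AE x in lborel. h x = 0"
proof -
  have hi: "h integrable_on cbox a b" and h0: "integral (cbox a b) h = 0" for a b
    using set_borel_integral_eq_integral[OF int[of a b]] zero[of a b] by simp_all
  obtain N where N: "negligible N"
    and lim: "\<And>x e. x \<notin> N \<Longrightarrow> 0 < e \<Longrightarrow> \<exists>d>0. \<forall>t. 0 < t \<and> t < d \<longrightarrow>
                 norm (integral (cbox x (x + t *\<^sub>R One)) h /\<^sub>R t ^ DIM('a) - h x) < e"
    using integrable_ccontinuous_explicit[OF hi] by metis
  have "h x = 0" if x: "x \<notin> N" for x
  proof (rule ccontr)
    assume "h x \<noteq> 0"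
    then have "\<exists>d>0. \<forall>t::real. 0 < t \<and> t < d \<longrightarrow> norm (h x) < norm (h x)"
      using lim[OF x, of "norm (h x)"] by (simp add: h0)
    then show False using dense by blast
  qed
  moreover have "AE x in lebesgue. x \<notin> N"
    using N by (intro AE_not_in) (simp add: negligible_iff_null_sets)
  ultimately have "AE x in lebesgue. h x = 0" by (auto elim: eventually_mono)
  then show ?thesis by (simp add: AE_completion_iff)
qed

lemma box_integral_gaussian_average:
  fixes f :: "'a::euclidean_space \<Rightarrow> complex"
  assumes f: "integrable lborel f"
  shows "(LINT y:cbox a b|lborel. LINT z|lborel. gaussian z * f (y + \<epsilon> *\<^sub>R z)) =
         (LINT z|lborel. gaussian z * (LINT y:cbox a b|lborel. f (y + \<epsilon> *\<^sub>R z)))"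
proof -
  have [measurable]: "f \<in> borel_measurable borel" using f by simp
  define k where "k = (\<lambda>(z::'a, y::'a). complex_of_real (indicator (cbox a b) y))"
  have shift: "integrable lborel (\<lambda>y. f (y + v))"
    "(LINT y|lborel. norm (f (y + v))) = (LINT y|lborel. norm (f y))" for v
    using integrable_lborel_affine[of 1 f v] integral_lborel_affine[of 1 "\<lambda>y. norm (f y)" v] f
    by (simp_all add: add.commute)
  have "integrable (lborel \<Otimes>\<^sub>M lborel) (\<lambda>(z, y). complex_of_real (gaussian z) * f (y + \<epsilon> *\<^sub>R z))"
  proof (rule lborel_pair.Fubini_integrable)
    show "(\<lambda>(z, y). complex_of_real (gaussian z) * f (y + \<epsilon> *\<^sub>R z)) \<in> borel_measurable (lborel \<Otimes>\<^sub>M lborel)"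
      by measurable
    show "integrable lborel (\<lambda>z. LINT y|lborel.
        norm (case (z, y) of (z, y) \<Rightarrow> complex_of_real (gaussian z) * f (y + \<epsilon> *\<^sub>R z)))"
      using integrable_norm[OF integrable_gaussian[where 'a='a]] by (simp add: norm_mult shift)
    show "AE z in lborel. integrable lborel
        (\<lambda>y. case (z, y) of (z, y) \<Rightarrow> complex_of_real (gaussian z) * f (y + \<epsilon> *\<^sub>R z))"
      by (simp add: shift)
  qed
  then have "integrable (lborel \<Otimes>\<^sub>M lborel)
      (\<lambda>w. k w * (case w of (z, y) \<Rightarrow> complex_of_real (gaussian z) * f (y + \<epsilon> *\<^sub>R z)))"
    by (rule integrable_unimodular_mult) (auto simp: k_def indicator_def)
  then have int: "integrable (lborel \<Otimes>\<^sub>M lborel)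
      (\<lambda>(z, y). k (z, y) * (complex_of_real (gaussian z) * f (y + \<epsilon> *\<^sub>R z)))"
    by (simp add: case_prod_beta')
  have "(LINT y:cbox a b|lborel. LINT z|lborel. gaussian z * f (y + \<epsilon> *\<^sub>R z)) =
        (LINT y|lborel. LINT z|lborel. k (z, y) * (complex_of_real (gaussian z) * f (y + \<epsilon> *\<^sub>R z)))"
    by (simp add: set_lebesgue_integral_def k_def scaleR_conv_of_real)
  also have "\<dots> = (LINT z|lborel. LINT y|lborel. k (z, y) * (complex_of_real (gaussian z) * f (y + \<epsilon> *\<^sub>R z)))"
    by (rule lborel_pair.Fubini_integral[OF int])
  also have "\<dots> = (LINT z|lborel. LINT y|lborel. gaussian z * (indicator (cbox a b) y *\<^sub>R f (y + \<epsilon> *\<^sub>R z)))"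
    by (simp add: k_def scaleR_conv_of_real mult.left_commute del: integral_mult_right_zero)
  finally show ?thesis by (simp only: set_lebesgue_integral_def integral_mult_right_zero)
qed

text \<open>
  The cutoff integrals \<open>A n\<close> tend boundedly to the inversion integral \<open>\<phi>\<close>.  Their integrals over a
  box are Gaussian averages of box integrals of translates of \<open>f\<close>, and so tend to
  \<open>(2\<pi>)\<^sup>N\<close> times the box integral of \<open>f\<close>: one factor \<open>S = (2\<pi>)\<^sup>N\<^sup>/\<^sup>2\<close> comes from the transform of
  the Gaussian, the other from its total mass.
\<close>

theorem fourier_inversion:
  fixes f :: "'a::euclidean_space \<Rightarrow> complex"
  assumes f: "integrable lborel f" and F: "integrable lborel (fourier f)"
  shows "AE x in lborel. (LINT \<xi>|lborel. fourier f \<xi> * cis (- (x \<bullet> \<xi>))) = (2 * pi) ^ DIM('a) * f x"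
proof -
  have fm[measurable]: "f \<in> borel_measurable borel" using f by simp
  have [measurable]: "fourier f \<in> borel_measurable borel" by measurable
  define \<phi> where "\<phi> x = (LINT \<xi>|lborel. fourier f \<xi> * cis (- (x \<bullet> \<xi>)))" for x
  define S where "S = complex_of_real (sqrt (2 * pi) ^ DIM('a))"
  define M where "M = (LINT \<xi>|lborel. norm (fourier f \<xi>))"
  define \<epsilon> where "\<epsilon> n = inverse (real (Suc n))" for n
  define A where "A n y = (LINT \<xi>|lborel. fourier f \<xi> * cis (- (y \<bullet> \<xi>)) * gaussian (\<epsilon> n *\<^sub>R \<xi>))" for n y
  have [measurable]: "\<phi> \<in> borel_measurable borel" "A n \<in> borel_measurable borel" for n
    unfolding \<phi>_def[abs_def] A_def[abs_def] by measurable
  have \<epsilon>0: "\<epsilon> \<longlonglongrightarrow> 0" and \<epsilon>_pos: "\<epsilon> n > 0" for n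
    unfolding \<epsilon>_def[abs_def] using LIMSEQ_inverse_real_of_nat by auto
  have S2: "S * S = (2 * pi) ^ DIM('a)"
    unfolding S_def of_real_mult[symmetric] power_mult_distrib[symmetric] by simp
  have gauss_total: "(LINT z::'a|lborel. complex_of_real (gaussian z)) = S"
    using fourier_gaussian[of "0::'a"] by (simp add: fourier_def S_def gaussian_def)
  have g_le: "\<bar>gaussian x\<bar> \<le> 1" for x :: 'a
    using gaussian_bounds[of x] by simp
  have A_bound: "norm (A n y) \<le> M" for n y
    unfolding A_def M_def
    by (rule order.trans[OF integral_norm_bound integral_mono'])
       (use F in \<open>auto simp: norm_mult intro!: mult_right_le_one_le g_le\<close>)
  have M: "M \<ge> 0" unfolding M_def by simp
  have \<phi>_bound: "norm (\<phi> y) \<le> M" for y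
    unfolding \<phi>_def M_def by (rule order.trans[OF integral_norm_bound]) (simp add: norm_mult)
  have box_M: "set_integrable lborel (cbox a b) (\<lambda>_. M)" for a b :: 'a
    unfolding set_integrable_def
    by (intro integrable_scaleR_left integrable_real_indicator) (use emeasure_lborel_cbox_finite in auto)
  have A_lim: "(\<lambda>n. A n y) \<longlonglongrightarrow> \<phi> y" for y
    unfolding A_def \<phi>_def
  proof (rule integral_dominated_convergence[where w="\<lambda>\<xi>. norm (fourier f \<xi>)"])
    have "(\<lambda>n. gaussian (\<epsilon> n *\<^sub>R \<xi>)) \<longlonglongrightarrow> 1" for \<xi> :: 'a
    proof -
      have "(\<lambda>n. gaussian (\<epsilon> n *\<^sub>R \<xi>)) \<longlonglongrightarrow> exp (- (norm (0 *\<^sub>R \<xi>))\<^sup>2 / 2)"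
        unfolding gaussian_def by (intro tendsto_intros \<epsilon>0) simp
      then show ?thesis by simp
    qed
    then have "(\<lambda>n. fourier f \<xi> * cis (- (y \<bullet> \<xi>)) * complex_of_real (gaussian (\<epsilon> n *\<^sub>R \<xi>))) \<longlonglongrightarrow>
        fourier f \<xi> * cis (- (y \<bullet> \<xi>)) * complex_of_real 1" for \<xi>
      by (intro tendsto_intros)
    then show "AE \<xi> in lborel. (\<lambda>n. fourier f \<xi> * cis (- (y \<bullet> \<xi>)) * complex_of_real (gaussian (\<epsilon> n *\<^sub>R \<xi>))) \<longlonglongrightarrow>
        fourier f \<xi> * cis (- (y \<bullet> \<xi>))"
      by simp
  qed (use F in \<open>auto simp: norm_mult intro!: mult_right_le_one_le g_le\<close>)
  have \<phi>_int: "set_integrable lborel (cbox a b) \<phi>" for a b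
    using box_M[of a b] \<phi>_bound unfolding set_integrable_def
    by (elim Bochner_Integration.integrable_bound) (auto simp: indicator_def M)
  have box_eq: "(LINT y:cbox a b|lborel. \<phi> y) = (2 * pi) ^ DIM('a) * (LINT y:cbox a b|lborel. f y)" for a b
  proof (rule LIMSEQ_unique)
    show "(\<lambda>n. LINT y:cbox a b|lborel. A n y) \<longlonglongrightarrow> (LINT y:cbox a b|lborel. \<phi> y)"
      unfolding set_lebesgue_integral_def
    proof (rule integral_dominated_convergence[where w="\<lambda>y. indicator (cbox a b) y *\<^sub>R M"])
      show "integrable lborel (\<lambda>y. indicator (cbox a b) y *\<^sub>R M)"
        using box_M unfolding set_integrable_def .
    qed (use A_lim A_bound M in \<open>auto simp: indicator_def intro!: tendsto_intros\<close>)
    have "(\<lambda>n. LINT z|lborel. complex_of_real (gaussian z) * (LINT y:cbox a b|lborel. f (y + \<epsilon> n *\<^sub>R z))) \<longlonglongrightarrow>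
        (LINT z|lborel. complex_of_real (gaussian (z::'a)) * (LINT y:cbox a b|lborel. f y))"
    proof (rule integral_dominated_convergence[where w="\<lambda>z. gaussian z * (LINT y|lborel. norm (f y))"])
      show "integrable lborel (\<lambda>z::'a. gaussian z * (LINT y|lborel. norm (f y)))"
        using integrable_gaussian[where 'a='a] by (simp add: complex_of_real_integrable_eq)
      show "AE z::'a in lborel. (\<lambda>n. complex_of_real (gaussian z) * (LINT y:cbox a b|lborel. f (y + \<epsilon> n *\<^sub>R z)))
          \<longlonglongrightarrow> complex_of_real (gaussian z) * (LINT y:cbox a b|lborel. f y)"
      proof (rule AE_I2)
        fix z :: 'a
        have "(\<lambda>n. \<epsilon> n *\<^sub>R z) \<longlonglongrightarrow> 0" using tendsto_scaleR[OF \<epsilon>0 tendsto_const[of z]] by simp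
        then show "(\<lambda>n. complex_of_real (gaussian z) * (LINT y:cbox a b|lborel. f (y + \<epsilon> n *\<^sub>R z)))
          \<longlonglongrightarrow> complex_of_real (gaussian z) * (LINT y:cbox a b|lborel. f y)"
          by (intro tendsto_intros box_integral_translation f)
      qed
      show "AE z::'a in lborel. norm (complex_of_real (gaussian z) * (LINT y:cbox a b|lborel. f (y + \<epsilon> n *\<^sub>R z)))
          \<le> gaussian z * (LINT y|lborel. norm (f y))" for n
      proof (rule AE_I2)
        fix z :: 'a
        have i: "integrable lborel (\<lambda>y. f (y + \<epsilon> n *\<^sub>R z))"
          using integrable_lborel_affine[of 1 f "\<epsilon> n *\<^sub>R z"] f by (simp add: add.commute)
        have "norm (LINT y:cbox a b|lborel. f (y + \<epsilon> n *\<^sub>R z)) \<le> (LINT y|lborel. norm (f (y + \<epsilon> n *\<^sub>R z)))"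
          unfolding set_lebesgue_integral_def
          by (rule order.trans[OF integral_norm_bound integral_mono'])
            (use i in \<open>auto simp: indicator_def\<close>)
        also have "\<dots> = (LINT y|lborel. norm (f y))"
          using integral_lborel_affine[of 1 "\<lambda>y. norm (f y)" "\<epsilon> n *\<^sub>R z"] by (simp add: add.commute)
        finally show "norm (complex_of_real (gaussian z) * (LINT y:cbox a b|lborel. f (y + \<epsilon> n *\<^sub>R z)))
          \<le> gaussian z * (LINT y|lborel. norm (f y))"
          using gaussian_bounds(1)[of z] by (simp add: norm_mult)
      qed
    qed (unfold set_lebesgue_integral_def, measurable)
    then have "(\<lambda>n. S * (LINT z|lborel. complex_of_real (gaussian z) * (LINT y:cbox a b|lborel. f (y + \<epsilon> n *\<^sub>R z)))) \<longlonglongrightarrow>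
        S * (S * (LINT y:cbox a b|lborel. f y))"
      by (intro tendsto_intros) (simp only: integral_mult_left_zero gauss_total)
    moreover have "(LINT y:cbox a b|lborel. A n y) =
      S * (LINT z|lborel. complex_of_real (gaussian z) * (LINT y:cbox a b|lborel. f (y + \<epsilon> n *\<^sub>R z)))" for n
      by (simp add: A_def fourier_gaussian_regularized[OF f \<epsilon>_pos] S_def box_integral_gaussian_average[OF f])
    ultimately show "(\<lambda>n. LINT y:cbox a b|lborel. A n y) \<longlonglongrightarrow>
        (2 * pi) ^ DIM('a) * (LINT y:cbox a b|lborel. f y)"
      unfolding S2[symmetric] mult.assoc by simp
  qed
  have f_int: "set_integrable lborel (cbox a b) (\<lambda>x. (2 * pi) ^ DIM('a) * f x)" for a b
    using f by (intro set_integrable_mult_right) (auto simp: set_integrable_def integrable_mult_indicator)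
  have "AE x in lborel. \<phi> x - (2 * pi) ^ DIM('a) * f x = 0"
  proof (rule AE_eq_0_if_box_integrals_eq_0)
    fix a b :: 'a
    show "set_integrable lborel (cbox a b) (\<lambda>x. \<phi> x - (2 * pi) ^ DIM('a) * f x)"
      by (intro set_integral_diff \<phi>_int f_int)
    show "(LINT x:cbox a b|lborel. \<phi> x - (2 * pi) ^ DIM('a) * f x) = 0"
      unfolding set_integral_diff(2)[OF \<phi>_int f_int] box_eq by simp
  qed
  then show ?thesis by (simp add: \<phi>_def)
qed

section \<open>The Fourier transform of a product\<close>

text \<open>
  The inversion formula bounds \<open>f\<close> almost everywhere by a multiple of the \<open>L\<^sup>1\<close> norm of its
  transform, whence \<open>f g\<close> is integrable.  In the convolution of the transforms, expand that
  of \<open>g\<close> and integrate first over the frequency: the inner integral is the inversion integral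
  of \<open>f\<close>.
\<close>

theorem
  fixes f g :: "'a::euclidean_space \<Rightarrow> complex"
  assumes f: "integrable lborel f" and g: "integrable lborel g"
    and F: "integrable lborel (fourier f)"
  shows integrable_mult_of_integrable_fourier: "integrable lborel (\<lambda>x. f x * g x)"
    and conv_fun_fourier:
      "conv_fun (fourier f) (fourier g) \<xi> = (2 * pi) ^ DIM('a) * fourier (\<lambda>x. f x * g x) \<xi>"
proof -
  have [measurable]: "f \<in> borel_measurable borel" "g \<in> borel_measurable borel" using f g by simp_all
  define \<phi> where "\<phi> x = (LINT \<xi>|lborel. fourier f \<xi> * cis (- (x \<bullet> \<xi>)))" for x
  define M where "M = (LINT \<xi>|lborel. norm (fourier f \<xi>))"
  define P :: real where "P = (2 * pi) ^ DIM('a)"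
  have P: "P > 0" by (simp add: P_def)
  have [measurable]: "\<phi> \<in> borel_measurable borel"
    unfolding \<phi>_def[abs_def] by measurable
  have \<phi>: "AE x in lborel. \<phi> x = P * f x"
    using fourier_inversion[OF f F] by (simp add: \<phi>_def P_def)
  have \<phi>_bound: "norm (\<phi> y) \<le> M" for y
    unfolding \<phi>_def M_def by (rule order.trans[OF integral_norm_bound]) (simp add: norm_mult)
  show "integrable lborel (\<lambda>x. f x * g x)"
  proof (rule Bochner_Integration.integrable_bound)
    show "integrable lborel (\<lambda>x. complex_of_real (M / P) * g x)" using g by simp
    show "AE x in lborel. norm (f x * g x) \<le> norm (complex_of_real (M / P) * g x)"
      using \<phi>
    proof eventually_elim
      case (elim x)
      have "P * norm (f x) \<le> M"
        using \<phi>_bound[of x] P by (simp add: elim norm_mult)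
      then have "norm (f x) \<le> \<bar>M / P\<bar>"
        using P by (simp add: field_simps abs_if)
      then show ?case by (simp only: norm_mult norm_of_real mult_right_mono norm_ge_zero)
    qed
  qed simp
  have k: "(LINT \<tau>|lborel. cis (y \<bullet> (\<xi> - \<tau>)) * fourier f \<tau>) = cis (y \<bullet> \<xi>) * \<phi> y" for y
  proof -
    have "cis (y \<bullet> (\<xi> - \<tau>)) * fourier f \<tau> = cis (y \<bullet> \<xi>) * (fourier f \<tau> * cis (- (y \<bullet> \<tau>)))" for \<tau>
      by (simp add: inner_diff_right cis_mult mult.left_commute[of _ "fourier f \<tau>"] mult.commute[of _ "fourier f \<tau>"])
    then show ?thesis by (simp only: \<phi>_def integral_mult_right_zero)
  qed
  have "conv_fun (fourier f) (fourier g) \<xi> =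
        (LINT \<tau>|lborel. fourier f \<tau> * (LINT y|lborel. cis (y \<bullet> (\<xi> - \<tau>)) * g y))"
    by (simp only: conv_fun_def fourier_def)
  also have "\<dots> = (LINT y|lborel. g y * (LINT \<tau>|lborel. cis (y \<bullet> (\<xi> - \<tau>)) * fourier f \<tau>))"
    using Fubini_mult[OF F g, of "\<lambda>(\<tau>, y). cis (y \<bullet> (\<xi> - \<tau>))"] by (auto simp: split_beta)
  also have "\<dots> = (LINT y|lborel. P * (cis (y \<bullet> \<xi>) * (f y * g y)))"
    unfolding k
  proof (rule integral_cong_AE)
    show "AE y in lborel. g y * (cis (y \<bullet> \<xi>) * \<phi> y) = P * (cis (y \<bullet> \<xi>) * (f y * g y))"
      using \<phi> by eventually_elim (simp only: mult_ac)
  qed measurable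
  finally show "conv_fun (fourier f) (fourier g) \<xi> = (2 * pi) ^ DIM('a) * fourier (\<lambda>x. f x * g x) \<xi>"
    by (simp only: P_def fourier_def integral_mult_right_zero)
qed

section \<open>Dilations\<close>

lemma fourier_scale:
  fixes h :: "'a::euclidean_space \<Rightarrow> complex"
  assumes [measurable]: "h \<in> borel_measurable borel" and s: "s > 0"
  shows "s ^ DIM('a) * fourier (\<lambda>x. h (s *\<^sub>R x)) \<xi> = fourier h (\<xi> /\<^sub>R s)"
proof -
  have inv: "inverse s * (s * t) = t" for t :: real using s by simp
  then show ?thesis
    using integral_lborel_affine[of s "\<lambda>x. cis (x \<bullet> (\<xi> /\<^sub>R s)) * h x" 0] s
    by (simp add: fourier_def scaleR_conv_of_real inv)
qed

definition diag_scale :: "real^'n \<Rightarrow> real^'n \<Rightarrow> real^'n" where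
  "diag_scale b x = (\<chi> k. b $ k * x $ k)"

lemma diag_scale_scaleR: "diag_scale b (r *\<^sub>R x) = r *\<^sub>R diag_scale b x"
  by (simp add: diag_scale_def vec_eq_iff)

lemma diag_scale_diff: "diag_scale b (x - y) = diag_scale b x - diag_scale b y"
  by (simp add: diag_scale_def vec_eq_iff algebra_simps)

lemma inj_axis: "inj (\<lambda>k. axis k (1::real) :: real^'n)"
  by (simp add: inj_def axis_eq_axis)

lemma
  fixes b :: "real^'n" and f :: "real^'n \<Rightarrow> complex"
  assumes b: "\<And>k. b $ k \<noteq> 0"
  shows integrable_diag_scale_iff:
      "integrable lborel (\<lambda>x. f (diag_scale b x)) \<longleftrightarrow> integrable lborel f"
    and integral_diag_scale:
      "f \<in> borel_measurable borel \<Longrightarrow>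
        integral\<^sup>L lborel f = (\<Prod>k\<in>UNIV. \<bar>b $ k\<bar>) *\<^sub>R (LINT x|lborel. f (diag_scale b x))"
proof -
  have B: "Basis = range (\<lambda>k. axis k (1::real) :: real^'n)" by (auto simp: Basis_vec_def)
  have eq: "(\<Sum>j\<in>Basis. ((c \<bullet> j) * (x \<bullet> j)) *\<^sub>R j) = diag_scale c x" for c x :: "real^'n"
    unfolding B sum.reindex[OF inj_axis] o_def inner_axis
    by (simp add: vec_eq_iff diag_scale_def axis_def if_distrib cong: if_cong)
  have nz: "c \<bullet> j \<noteq> 0" if "\<And>k. c $ k \<noteq> 0" "j \<in> Basis" for c j :: "real^'n"
    using that by (auto simp: Basis_vec_def inner_axis)
  have int: "integrable lborel (\<lambda>x. f (diag_scale c x))"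
    if "integrable lborel f" "\<And>k. c $ k \<noteq> 0" for f :: "real^'n \<Rightarrow> complex" and c :: "real^'n"
    using integrable_lborel_diagonal[of "\<lambda>j. c \<bullet> j" f 0] that nz[of c] by (simp add: eq)
  show "integrable lborel (\<lambda>x. f (diag_scale b x)) \<longleftrightarrow> integrable lborel f"
  proof
    assume "integrable lborel (\<lambda>x. f (diag_scale b x))"
    moreover have "diag_scale b (diag_scale (\<chi> k. inverse (b $ k)) x) = x" for x
      using b by (simp add: diag_scale_def vec_eq_iff flip: mult.assoc)
    ultimately show "integrable lborel f"
      using int[of "\<lambda>x. f (diag_scale b x)" "\<chi> k. inverse (b $ k)"] b by simp
  qed (use int b in blast)
  have "(\<Prod>j\<in>Basis. \<bar>b \<bullet> j\<bar>) = (\<Prod>k\<in>UNIV. \<bar>b $ k\<bar>)"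
    unfolding B by (subst prod.reindex[OF inj_axis]) (simp add: inner_axis)
  then show "integral\<^sup>L lborel f = (\<Prod>k\<in>UNIV. \<bar>b $ k\<bar>) *\<^sub>R (LINT x|lborel. f (diag_scale b x))"
    if "f \<in> borel_measurable borel"
    using integral_lborel_diagonal[of "\<lambda>j. b \<bullet> j" f 0] that nz[of b] b by (simp add: eq)
qed

section \<open>From Lebesgue to Borel measurable functions\<close>

text \<open>
  The left-hand sides are about a function that need not be Borel.  It is Lebesgue measurable
  because the completed measure contains all subsets of null sets.
\<close>

lemma lebesgue_cong_borel:
  fixes f g :: "'a::euclidean_space \<Rightarrow> complex"
  assumes g[measurable]: "g \<in> borel_measurable borel" and ae: "AE x in lborel. f x = g x"
  shows "integrable lebesgue f \<longleftrightarrow> integrable lborel g"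
    and "integral\<^sup>L lebesgue f = integral\<^sup>L lborel g"
proof -
  have g': "g \<in> borel_measurable lebesgue" by (intro measurable_completion) simp
  have ae': "AE x in lebesgue. f x = g x" using ae by (simp add: AE_completion_iff)
  have f': "f \<in> borel_measurable lebesgue"
  proof (rule measurableI)
    fix A :: "complex set" assume A: "A \<in> sets borel"
    show "f -` A \<inter> space lebesgue \<in> sets lebesgue"
    proof (rule completion.in_sets_AE)
      show "g -` A \<inter> space lebesgue \<in> sets lebesgue" using measurable_sets[OF g' A] .
      show "AE x in lebesgue. x \<in> g -` A \<inter> space lebesgue \<longleftrightarrow> x \<in> f -` A \<inter> space lebesgue"
        using ae' by eventually_elim simp
    qed simp
  qed simp
  show "integrable lebesgue f \<longleftrightarrow> integrable lborel g"
    using integrable_cong_AE[OF f' g' ae'] integrable_completion[of g lborel] by simp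
  show "integral\<^sup>L lebesgue f = integral\<^sup>L lborel g"
    using integral_cong_AE[OF f' g' ae'] integral_completion[of g lborel] by simp
qed

lemma integrable_lebesgue_borel_representative:
  fixes f :: "'a::euclidean_space \<Rightarrow> complex"
  assumes f: "integrable lebesgue f"
  obtains g where "integrable lborel g" "AE x in lborel. f x = g x"
proof -
  have "(\<lambda>x. Re (f x)) \<in> borel_measurable lebesgue" "(\<lambda>x. Im (f x)) \<in> borel_measurable lebesgue"
    using borel_measurable_integrable[OF f] by simp_all
  then obtain u v where [measurable]: "u \<in> borel_measurable lborel" "v \<in> borel_measurable lborel"
    and uv: "AE x in lborel. Re (f x) = u x" "AE x in lborel. Im (f x) = v x"
    using completion_ex_borel_measurable_real by metis
  have ae: "AE x in lborel. f x = Complex (u x) (v x)"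
    using uv by eventually_elim (simp add: complex_eq_iff)
  have m: "(\<lambda>x. Complex (u x) (v x)) \<in> borel_measurable borel"
    unfolding Complex_eq by measurable
  show ?thesis
    using that[OF _ ae] lebesgue_cong_borel(1)[OF m ae] f by simp
qed

section \<open>The QPFT as a chirped Fourier transform\<close>

definition chirp :: "real^'n \<Rightarrow> real^'n \<Rightarrow> real^'n \<Rightarrow> complex" where
  "chirp p q x = cis (\<Sum>k\<in>UNIV. p $ k * (x $ k)\<^sup>2 + q $ k * x $ k)"

lemma chirp_measurable [measurable]: "chirp p q \<in> borel_measurable borel"
  unfolding chirp_def[abs_def]
  by (intro borel_measurable_continuous_onI continuous_intros)

lemma norm_chirp [simp]: "norm (chirp p q x) = 1"
  by (simp add: chirp_def)

lemma chirp_inverse: "chirp p q x * chirp (- p) (- q) x = 1"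
  by (simp add: chirp_def cis_mult flip: sum.distrib)

lemma cis_sum: "finite A \<Longrightarrow> cis (sum f A) = (\<Prod>k\<in>A. cis (f k))"
  by (simp add: cis_conv_exp exp_sum sum_distrib_left)

text \<open>
  The polarisation identity behind \<open>\<oplus>\<close>: with \<open>y = \<surd>2 x - \<tau>\<close> one has \<open>x\<^sub>k / \<surd>2 - \<tau>\<^sub>k = (y\<^sub>k - \<tau>\<^sub>k) / 2\<close>
  and \<open>(y\<^sub>k - \<tau>\<^sub>k)\<^sup>2 = 2 (y\<^sub>k\<^sup>2 + \<tau>\<^sub>k\<^sup>2) - (y\<^sub>k + \<tau>\<^sub>k)\<^sup>2 = 2 (y\<^sub>k\<^sup>2 + \<tau>\<^sub>k\<^sup>2) - 2 x\<^sub>k\<^sup>2\<close>.  The operation \<open>\<ominus>\<close> uses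
  the same identity with \<open>p = - c\<close> and \<open>q = - e\<close>.
\<close>

lemma chirp_weight:
  "cis (\<Sum>k\<in>UNIV. 2 * (p $ k * (x $ k / sqrt 2 - \<tau> $ k)\<^sup>2) + (sqrt 2 - 1) * q $ k * x $ k) =
   chirp (- p) (- q) x * (chirp p q \<tau> * chirp p q (sqrt 2 *\<^sub>R x - \<tau>))"
proof -
  have "2 * (P * (X / sqrt 2 - T)\<^sup>2) + (sqrt 2 - 1) * Q * X =
     (- P * X\<^sup>2 + - Q * X) + ((P * T\<^sup>2 + Q * T) + (P * (sqrt 2 * X - T)\<^sup>2 + Q * (sqrt 2 * X - T)))"
    for P Q X T :: real
  proof -
    \<comment> \<open>in terms of \<open>h = 1 / \<surd>2\<close> the claim is a polynomial identity modulo \<open>2 h\<^sup>2 = 1\<close>\<close>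
    define h where "h = inverse (sqrt (2::real))"
    have h: "sqrt 2 = 2 * h" "X / sqrt 2 = h * X" "2 * (h * h) = 1"
      by (simp_all add: h_def field_simps)
    show ?thesis unfolding h(2) unfolding h(1) using h(3) by algebra
  qed
  then show ?thesis by (simp add: chirp_def cis_mult flip: sum.distrib)
qed

text \<open>
  Two copies of the quadratic part at \<open>x / \<surd>2\<close> add up to the quadratic part at \<open>x\<close>, but two copies
  of the linear part add up to \<open>\<surd>2 q \<bullet> x\<close> instead of \<open>q \<bullet> x\<close>; the first factor corrects this.  It is
  the source of the exponential factors in both identities of the theorem.
\<close>

lemma chirp_half:
  "cis (\<Sum>k\<in>UNIV. (sqrt 2 - 1) * q $ k * x $ k) * chirp p q x =
   chirp p q (x /\<^sub>R sqrt 2) * chirp p q (x /\<^sub>R sqrt 2)"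
proof -
  have "(sqrt 2 - 1) * Q * X + (P * X\<^sup>2 + Q * X) =
     (P * (inverse (sqrt 2) * X)\<^sup>2 + Q * (inverse (sqrt 2) * X)) +
     (P * (inverse (sqrt 2) * X)\<^sup>2 + Q * (inverse (sqrt 2) * X))" for P Q X :: real
  proof -
    define h where "h = inverse (sqrt (2::real))"
    have h: "sqrt 2 = 2 * h" "2 * (h * h) = 1"
      by (simp_all add: h_def field_simps)
    show ?thesis unfolding h_def[symmetric] unfolding h(1) using h(2) by algebra
  qed
  then show ?thesis by (simp add: chirp_def cis_mult flip: sum.distrib)
qed

definition qp_const :: "real^'n \<Rightarrow> complex" where
  "qp_const b = (\<Prod>k\<in>UNIV. csqrt (complex_of_real (b $ k) / (2 * complex_of_real pi * \<i>)))"

lemma qp_const_nonzero: "(\<And>k. b $ k \<noteq> 0) \<Longrightarrow> qp_const b \<noteq> 0"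
  by (simp add: qp_const_def)

lemma conv_const_eq:
  "(\<Prod>k\<in>UNIV. csqrt (complex_of_real (b $ k) / (complex_of_real pi * \<i>))) =
   sqrt 2 ^ CARD('n) * qp_const (b :: real^'n)"
proof -
  have "csqrt (complex_of_real r / (complex_of_real pi * \<i>)) =
     sqrt 2 * csqrt (complex_of_real r / (2 * complex_of_real pi * \<i>))" for r
  proof (rule csqrt_unique)
    let ?w = "csqrt (complex_of_real r / (2 * complex_of_real pi * \<i>))"
    show "(sqrt 2 * ?w)\<^sup>2 = complex_of_real r / (complex_of_real pi * \<i>)"
      by (simp add: power_mult_distrib flip: of_real_power)
    show "0 < Re (sqrt 2 * ?w) \<or> Re (sqrt 2 * ?w) = 0 \<and> 0 \<le> Im (sqrt 2 * ?w)"
      using csqrt_principal[of "complex_of_real r / (2 * complex_of_real pi * \<i>)"] by auto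
  qed
  then show ?thesis by (simp add: qp_const_def prod.distrib)
qed

text \<open>
  The two radicands, \<open>2 z\<close> and \<open>cnj z\<close> with \<open>z = \<i> b\<^sub>k / (2\<pi>)\<close>, lie off the negative real axis.  There the
  principal square root commutes with conjugation, so that each product of roots is
  \<open>\<surd>2 \<bar>csqrt z\<bar>\<^sup>2 = \<surd>2 \<bar>z\<bar>\<close>, whatever the sign of \<open>b\<^sub>k\<close>.
\<close>

lemma dual_const_eq:
  fixes b :: "real^'n"
  assumes b: "\<And>k. b $ k \<noteq> 0"
  shows "(\<Prod>k\<in>UNIV. csqrt (\<i> * complex_of_real (b $ k) / complex_of_real pi)) * qp_const b
      * (2 * pi) ^ CARD('n) = sqrt 2 ^ CARD('n) * (\<Prod>k\<in>UNIV. \<bar>b $ k\<bar>)"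
proof -
  have factor: "csqrt (\<i> * complex_of_real r / complex_of_real pi) *
      csqrt (complex_of_real r / (2 * complex_of_real pi * \<i>)) * (2 * pi) = sqrt 2 * \<bar>r\<bar>"
    if r: "r \<noteq> 0" for r
  proof -
    define z where "z = \<i> * complex_of_real (r / (2 * pi))"
    have z: "z \<notin> \<real>\<^sub>\<le>\<^sub>0"
      using r by (auto simp: z_def complex_nonpos_Reals_iff)
    have "csqrt (\<i> * complex_of_real r / complex_of_real pi) = sqrt 2 * csqrt z"
    proof (rule csqrt_unique)
      show "(sqrt 2 * csqrt z)\<^sup>2 = \<i> * complex_of_real r / complex_of_real pi"
        by (simp add: power_mult_distrib z_def flip: of_real_power)
      show "0 < Re (sqrt 2 * csqrt z) \<or> Re (sqrt 2 * csqrt z) = 0 \<and> 0 \<le> Im (sqrt 2 * csqrt z)"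
        using csqrt_principal[of z] by auto
    qed
    moreover have "csqrt (complex_of_real r / (2 * complex_of_real pi * \<i>)) = cnj (csqrt z)"
    proof -
      have "complex_of_real r / (2 * complex_of_real pi * \<i>) = cnj z"
        by (simp add: z_def field_simps)
      then show ?thesis using cnj_csqrt[OF z] by simp
    qed
    moreover have "csqrt z * cnj (csqrt z) = \<bar>r\<bar> / (2 * pi)"
      unfolding complex_norm_square[symmetric] by (simp add: z_def norm_mult norm_divide flip: of_real_power)
    ultimately show ?thesis by (simp add: mult.assoc)
  qed
  have "(\<Prod>k\<in>UNIV. csqrt (\<i> * complex_of_real (b $ k) / complex_of_real pi) *
      csqrt (complex_of_real (b $ k) / (2 * complex_of_real pi * \<i>)) * complex_of_real (2 * pi)) =
      (\<Prod>k\<in>UNIV. complex_of_real (sqrt 2 * \<bar>b $ k\<bar>))"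
    by (intro prod.cong refl factor b)
  then show ?thesis
    by (simp add: qp_const_def prod.distrib)
qed

lemma qp_kernel_eq:
  "qp_kernel a b c d e \<omega> x =
   qp_const b * chirp c e \<omega> * (cis (x \<bullet> diag_scale b \<omega>) * chirp a d x)"
proof -
  have "(\<Prod>k\<in>UNIV. exp (\<i> * complex_of_real
          (a $ k * (x $ k)\<^sup>2 + b $ k * x $ k * \<omega> $ k + c $ k * (\<omega> $ k)\<^sup>2
           + d $ k * x $ k + e $ k * \<omega> $ k))) =
        cis (\<Sum>k\<in>UNIV. (c $ k * (\<omega> $ k)\<^sup>2 + e $ k * \<omega> $ k) +
            (x $ k * (b $ k * \<omega> $ k) + (a $ k * (x $ k)\<^sup>2 + d $ k * x $ k)))"
    unfolding cis_sum[OF finite] cis_conv_exp[symmetric]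
    by (intro prod.cong refl arg_cong[of _ _ cis]) (simp add: algebra_simps)
  then show ?thesis
    unfolding qp_kernel_def prod.distrib qp_const_def[symmetric]
    by (simp add: chirp_def inner_vec_def diag_scale_def sum.distrib flip: cis_mult)
qed

lemma qpft_eq_fourier:
  assumes [measurable]: "f' \<in> borel_measurable borel" and ae: "AE x in lborel. f x = f' x"
  shows "qpft a b c d e f \<omega> =
     qp_const b * chirp c e \<omega> * fourier (\<lambda>x. chirp a d x * f' x) (diag_scale b \<omega>)"
proof -
  have "qpft a b c d e f \<omega> = (LINT x|lborel. qp_const b * chirp c e \<omega> *
     (cis (x \<bullet> diag_scale b \<omega>) * (chirp a d x * f' x)))"
    unfolding qpft_def
  proof (rule lebesgue_cong_borel)
    show "AE x in lborel. qp_kernel a b c d e \<omega> x * f x = qp_const b * chirp c e \<omega> *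
     (cis (x \<bullet> diag_scale b \<omega>) * (chirp a d x * f' x))"
      using ae by eventually_elim (simp only: qp_kernel_eq mult.assoc)
  qed measurable
  then show ?thesis by (simp only: fourier_def integral_mult_right_zero)
qed

text \<open>
  The common form of the integrals in \<open>\<oplus>\<close> and \<open>\<ominus>\<close>.
\<close>

lemma weighted_integral_eq_conv_fun:
  assumes [measurable]: "f' \<in> borel_measurable borel" "g' \<in> borel_measurable borel"
    and f: "AE x in lborel. f x = f' x" and g: "AE x in lborel. g x = g' x"
  shows "(LINT \<tau>|lebesgue. f \<tau> * g (sqrt 2 *\<^sub>R x - \<tau>) *
       cis (\<Sum>k\<in>UNIV. 2 * (p $ k * (x $ k / sqrt 2 - \<tau> $ k)\<^sup>2) + (sqrt 2 - 1) * q $ k * x $ k)) =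
     chirp (- p) (- q) x *
       conv_fun (\<lambda>y. chirp p q y * f' y) (\<lambda>y. chirp p q y * g' y) (sqrt 2 *\<^sub>R x)"
proof -
  have g2: "AE \<tau> in lborel. g (sqrt 2 *\<^sub>R x - \<tau>) = g' (sqrt 2 *\<^sub>R x - \<tau>)"
    using AE_lborel_affine[OF _ g, of "-1" "sqrt 2 *\<^sub>R x"] by simp
  have "(LINT \<tau>|lebesgue. f \<tau> * g (sqrt 2 *\<^sub>R x - \<tau>) *
       cis (\<Sum>k\<in>UNIV. 2 * (p $ k * (x $ k / sqrt 2 - \<tau> $ k)\<^sup>2) + (sqrt 2 - 1) * q $ k * x $ k)) =
     (LINT \<tau>|lborel. chirp (- p) (- q) x * (chirp p q \<tau> * f' \<tau> *
       (chirp p q (sqrt 2 *\<^sub>R x - \<tau>) * g' (sqrt 2 *\<^sub>R x - \<tau>))))"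
    unfolding chirp_weight
  proof (rule lebesgue_cong_borel)
    show "AE \<tau> in lborel. f \<tau> * g (sqrt 2 *\<^sub>R x - \<tau>) *
       (chirp (- p) (- q) x * (chirp p q \<tau> * chirp p q (sqrt 2 *\<^sub>R x - \<tau>))) =
       chirp (- p) (- q) x * (chirp p q \<tau> * f' \<tau> *
       (chirp p q (sqrt 2 *\<^sub>R x - \<tau>) * g' (sqrt 2 *\<^sub>R x - \<tau>)))"
      using f g2 by eventually_elim (simp only: mult_ac)
  qed measurable
  then show ?thesis by (simp only: conv_fun_def integral_mult_right_zero)
qed

lemma qp_conv_eq:
  fixes b :: "real^'n"
  assumes "f' \<in> borel_measurable borel" "g' \<in> borel_measurable borel"
    and "AE x in lborel. f x = f' x" "AE x in lborel. g x = g' x"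
  shows "qp_conv a b d f g x = sqrt 2 ^ CARD('n) * qp_const b * (chirp (- a) (- d) x *
       conv_fun (\<lambda>y. chirp a d y * f' y) (\<lambda>y. chirp a d y * g' y) (sqrt 2 *\<^sub>R x))"
proof -
  have "(\<Sum>k\<in>UNIV. 2 * \<i> * complex_of_real (a $ k * (x $ k / sqrt 2 - \<tau> $ k)\<^sup>2)
                      + \<i> * complex_of_real ((sqrt 2 - 1) * d $ k * x $ k)) =
      \<i> * complex_of_real (\<Sum>k\<in>UNIV. 2 * (a $ k * (x $ k / sqrt 2 - \<tau> $ k)\<^sup>2) + (sqrt 2 - 1) * d $ k * x $ k)"
    for \<tau> unfolding of_real_sum sum_distrib_left by (intro sum.cong refl) (simp add: algebra_simps)
  then show ?thesis
    unfolding qp_conv_def conv_const_eq weighted_integral_eq_conv_fun[OF assms, symmetric] cis_conv_exp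
    by simp
qed

lemma qp_dual_conv_eq:
  fixes b :: "real^'n"
  assumes "f' \<in> borel_measurable borel" "g' \<in> borel_measurable borel"
    and "AE x in lborel. f x = f' x" "AE x in lborel. g x = g' x"
  shows "qp_dual_conv b c e f g x =
     (\<Prod>k\<in>UNIV. csqrt (\<i> * complex_of_real (b $ k) / complex_of_real pi)) * (chirp c e x *
       conv_fun (\<lambda>y. chirp (- c) (- e) y * f' y) (\<lambda>y. chirp (- c) (- e) y * g' y) (sqrt 2 *\<^sub>R x))"
proof -
  have "- (\<Sum>k\<in>UNIV. 2 * \<i> * complex_of_real (c $ k * (x $ k / sqrt 2 - \<tau> $ k)\<^sup>2)
                      + \<i> * complex_of_real ((sqrt 2 - 1) * e $ k * x $ k)) =
      \<i> * complex_of_real (\<Sum>k\<in>UNIV. 2 * ((- c) $ k * (x $ k / sqrt 2 - \<tau> $ k)\<^sup>2) + (sqrt 2 - 1) * (- e) $ k * x $ k)"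
    for \<tau> unfolding of_real_sum sum_distrib_left sum_negf[symmetric]
    by (intro sum.cong refl) (simp add: algebra_simps)
  then show ?thesis
    using weighted_integral_eq_conv_fun[OF assms, where p="- c" and q="- e"]
    unfolding qp_dual_conv_def cis_conv_exp by simp
qed

section \<open>The convolution theorems for the QPFT\<close>

theorem theorem3p10:
  fixes a b c d e :: "real^'n"
    and f g :: "real^'n \<Rightarrow> complex"
  assumes "\<And>k. b $ k \<noteq> 0"
    and "integrable lebesgue f"
    and "integrable lebesgue g"
  shows "(integrable lebesgue (qp_conv a b d f g) \<and>
          (\<forall>\<omega>. qpft a b c d e (qp_conv a b d f g) \<omega> =
             exp (- \<i> * (\<Sum>k\<in>UNIV. complex_of_real ((sqrt 2 - 1) * e $ k * \<omega> $ k))) *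
             qpft a b c d e f (\<omega> /\<^sub>R sqrt 2) * qpft a b c d e g (\<omega> /\<^sub>R sqrt 2)))
       \<and> (integrable lebesgue (qpft a b c d e f) \<and> integrable lebesgue (qpft a b c d e g) \<longrightarrow>
          integrable lebesgue
            (\<lambda>x. exp (\<i> * (\<Sum>k\<in>UNIV. complex_of_real ((sqrt 2 - 1) * d $ k * x $ k))) *
                 f (x /\<^sub>R sqrt 2) * g (x /\<^sub>R sqrt 2)) \<and>
          (\<forall>\<omega>. qpft a b c d e
             (\<lambda>x. exp (\<i> * (\<Sum>k\<in>UNIV. complex_of_real ((sqrt 2 - 1) * d $ k * x $ k))) *
                  f (x /\<^sub>R sqrt 2) * g (x /\<^sub>R sqrt 2)) \<omega> =
             qp_dual_conv b c e (qpft a b c d e f) (qpft a b c d e g) \<omega>))"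
proof -
  note b = assms(1)
  obtain f' where f'_int: "integrable lborel f'" and f': "AE x in lborel. f x = f' x"
    using integrable_lebesgue_borel_representative[OF assms(2)] .
  obtain g' where g'_int: "integrable lborel g'" and g': "AE x in lborel. g x = g' x"
    using integrable_lebesgue_borel_representative[OF assms(3)] .
  define F where "F x = chirp a d x * f' x" for x
  define G where "G x = chirp a d x * g' x" for x
  have f'm[measurable]: "f' \<in> borel_measurable borel" and g'm[measurable]: "g' \<in> borel_measurable borel"
    using f'_int g'_int by simp_all
  have F: "integrable lborel F" and G: "integrable lborel G"
    unfolding F_def G_def using f'_int g'_int by (auto intro!: integrable_unimodular_mult)
  have [measurable]: "F \<in> borel_measurable borel" "G \<in> borel_measurable borel"
    using F G by simp_all
  have Qf: "qpft a b c d e f \<omega> = qp_const b * chirp c e \<omega> * fourier F (diag_scale b \<omega>)"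
    and Qg: "qpft a b c d e g \<omega> = qp_const b * chirp c e \<omega> * fourier G (diag_scale b \<omega>)" for \<omega>
    unfolding F_def[abs_def] G_def[abs_def]
    by (rule qpft_eq_fourier[OF f'm f'] qpft_eq_fourier[OF g'm g'])+
  have half: "exp (\<i> * (\<Sum>k\<in>UNIV. complex_of_real ((sqrt 2 - 1) * q $ k * x $ k))) * chirp p q x =
      chirp p q (x /\<^sub>R sqrt 2) * chirp p q (x /\<^sub>R sqrt 2)" for p q x :: "real^'n"
    unfolding of_real_sum[symmetric] cis_conv_exp[symmetric] by (rule chirp_half)

  have first: "integrable lebesgue (qp_conv a b d f g) \<and>
      qpft a b c d e (qp_conv a b d f g) \<omega> =
        exp (- \<i> * (\<Sum>k\<in>UNIV. complex_of_real ((sqrt 2 - 1) * e $ k * \<omega> $ k))) *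
        qpft a b c d e f (\<omega> /\<^sub>R sqrt 2) * qpft a b c d e g (\<omega> /\<^sub>R sqrt 2)" for \<omega>
  proof
    define C where "C = sqrt 2 ^ CARD('n) * qp_const b"
    define H where "H x = C * conv_fun F G (sqrt 2 *\<^sub>R x)" for x
    have conv: "qp_conv a b d f g = (\<lambda>x. chirp (- a) (- d) x * H x)"
      unfolding qp_conv_eq[OF f'm g'm f' g'] H_def C_def F_def[abs_def] G_def[abs_def]
      by (simp add: mult_ac)
    have FG: "integrable lborel (conv_fun F G)" by (rule integrable_conv_fun[OF F G])
    then have [measurable]: "conv_fun F G \<in> borel_measurable borel" by simp
    have "integrable lborel (\<lambda>x. conv_fun F G (sqrt 2 *\<^sub>R x))"
      using integrable_lborel_affine[OF _ FG, of "sqrt 2" 0] by simp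
    then have H: "integrable lborel H" unfolding H_def[abs_def] by simp
    then have [measurable]: "H \<in> borel_measurable borel" by simp
    have "integrable lborel (qp_conv a b d f g)"
      unfolding conv using H by (intro integrable_unimodular_mult) simp_all
    then show "integrable lebesgue (qp_conv a b d f g)"
      by (simp add: integrable_completion)
    have conv_m: "qp_conv a b d f g \<in> borel_measurable borel"
      unfolding conv by measurable
    \<comment> \<open>the outer chirp of the convolution cancels the chirp of the QPFT\<close>
    have dechirp: "(\<lambda>x. chirp a d x * qp_conv a b d f g x) = H"
      unfolding conv by (simp add: chirp_inverse flip: mult.assoc)
    have "fourier H \<xi> = C * fourier (\<lambda>x. conv_fun F G (sqrt 2 *\<^sub>R x)) \<xi>" for \<xi>
      unfolding fourier_def H_def by (subst integral_mult_right_zero[symmetric]) (simp only: mult_ac)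
    also have "\<dots> \<xi> = qp_const b * (fourier F (\<xi> /\<^sub>R sqrt 2) * fourier G (\<xi> /\<^sub>R sqrt 2))" for \<xi>
      unfolding fourier_conv_fun[OF F G, symmetric] C_def
      using fourier_scale[of "conv_fun F G" "sqrt 2" \<xi>] by simp
    finally have FH: "fourier H \<xi> = qp_const b * (fourier F (\<xi> /\<^sub>R sqrt 2) * fourier G (\<xi> /\<^sub>R sqrt 2))" for \<xi> .
    have E: "exp (- \<i> * (\<Sum>k\<in>UNIV. complex_of_real ((sqrt 2 - 1) * e $ k * \<omega> $ k))) *
      (chirp c e (\<omega> /\<^sub>R sqrt 2) * chirp c e (\<omega> /\<^sub>R sqrt 2)) = chirp c e \<omega>"
      unfolding half[symmetric] by (simp add: exp_minus)
    have "qpft a b c d e (qp_conv a b d f g) \<omega> =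
        qp_const b * chirp c e \<omega> * fourier H (diag_scale b \<omega>)"
      using qpft_eq_fourier[OF conv_m, of "qp_conv a b d f g"] by (simp add: dechirp)
    then show "qpft a b c d e (qp_conv a b d f g) \<omega> =
        exp (- \<i> * (\<Sum>k\<in>UNIV. complex_of_real ((sqrt 2 - 1) * e $ k * \<omega> $ k))) *
        qpft a b c d e f (\<omega> /\<^sub>R sqrt 2) * qpft a b c d e g (\<omega> /\<^sub>R sqrt 2)"
      unfolding Qf Qg FH E[symmetric] diag_scale_scaleR by (simp only: mult_ac)
  qed

  have second: "integrable lebesgue
            (\<lambda>x. exp (\<i> * (\<Sum>k\<in>UNIV. complex_of_real ((sqrt 2 - 1) * d $ k * x $ k))) *
                 f (x /\<^sub>R sqrt 2) * g (x /\<^sub>R sqrt 2)) \<and>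
      qpft a b c d e
             (\<lambda>x. exp (\<i> * (\<Sum>k\<in>UNIV. complex_of_real ((sqrt 2 - 1) * d $ k * x $ k))) *
                  f (x /\<^sub>R sqrt 2) * g (x /\<^sub>R sqrt 2)) \<omega> =
             qp_dual_conv b c e (qpft a b c d e f) (qpft a b c d e g) \<omega>"
    if int: "integrable lebesgue (qpft a b c d e f)" for \<omega>
  proof
    define w where "w x = exp (\<i> * (\<Sum>k\<in>UNIV. complex_of_real ((sqrt 2 - 1) * d $ k * x $ k)))" for x :: "real^'n"
    define P where "P x = w x * f (x /\<^sub>R sqrt 2) * g (x /\<^sub>R sqrt 2)" for x
    define P' where "P' x = w x * f' (x /\<^sub>R sqrt 2) * g' (x /\<^sub>R sqrt 2)" for x
    have w[measurable]: "w \<in> borel_measurable borel"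
      unfolding w_def[abs_def] by (intro borel_measurable_continuous_onI continuous_intros)
    have P'_m: "P' \<in> borel_measurable borel" unfolding P'_def[abs_def] by measurable
    have "AE x in lborel. f (x /\<^sub>R sqrt 2) = f' (x /\<^sub>R sqrt 2)"
      "AE x in lborel. g (x /\<^sub>R sqrt 2) = g' (x /\<^sub>R sqrt 2)"
      using AE_lborel_affine[OF _ f', of "inverse (sqrt 2)" 0]
        AE_lborel_affine[OF _ g', of "inverse (sqrt 2)" 0] by simp_all
    then have P_ae: "AE x in lborel. P x = P' x"
      by eventually_elim (simp only: P_def P'_def)
    have chirp_P': "chirp a d x * P' x = F (inverse (sqrt 2) *\<^sub>R x) * G (inverse (sqrt 2) *\<^sub>R x)" for x
    proof -
      have "chirp a d x * P' x = (w x * chirp a d x) * (f' (x /\<^sub>R sqrt 2) * g' (x /\<^sub>R sqrt 2))"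
        by (simp only: P'_def mult_ac)
      also have "w x * chirp a d x = chirp a d (x /\<^sub>R sqrt 2) * chirp a d (x /\<^sub>R sqrt 2)"
        unfolding w_def by (rule half)
      finally show ?thesis by (simp only: F_def G_def mult_ac)
    qed
    have Qf_m: "(\<lambda>\<omega>. qpft a b c d e f \<omega>) \<in> borel_measurable borel"
      and Qg_m: "(\<lambda>\<omega>. qpft a b c d e g \<omega>) \<in> borel_measurable borel"
    proof -
      have [measurable]: "diag_scale b \<in> borel_measurable borel"
        unfolding diag_scale_def[abs_def] by (intro borel_measurable_continuous_onI continuous_intros)
      show "(\<lambda>\<omega>. qpft a b c d e f \<omega>) \<in> borel_measurable borel"
        "(\<lambda>\<omega>. qpft a b c d e g \<omega>) \<in> borel_measurable borel"
        unfolding Qf Qg by measurable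
    qed
    have dechirp_f: "chirp (- c) (- e) \<omega> * qpft a b c d e f \<omega> = qp_const b * fourier F (diag_scale b \<omega>)"
      and dechirp_g: "chirp (- c) (- e) \<omega> * qpft a b c d e g \<omega> = qp_const b * fourier G (diag_scale b \<omega>)" for \<omega>
      using chirp_inverse[of c e \<omega>] unfolding Qf Qg by algebra+
    have FF: "integrable lborel (fourier F)"
    proof -
      have "integrable lborel (qpft a b c d e f)"
        using int Qf_m by (simp add: integrable_completion)
      then have "integrable lborel (\<lambda>\<omega>. chirp (- c) (- e) \<omega> * qpft a b c d e f \<omega>)"
        by (intro integrable_unimodular_mult) simp_all
      then have "integrable lborel (\<lambda>\<omega>. inverse (qp_const b) * (qp_const b * fourier F (diag_scale b \<omega>)))"
        unfolding dechirp_f by (rule integrable_mult_right)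
      then have "integrable lborel (\<lambda>\<omega>. fourier F (diag_scale b \<omega>))"
        using qp_const_nonzero[OF b] by (simp flip: mult.assoc)
      then show ?thesis using integrable_diag_scale_iff[OF b] by blast
    qed
    have FG: "integrable lborel (\<lambda>x. F x * G x)"
      by (rule integrable_mult_of_integrable_fourier[OF F G FF])
    have FG_scaled: "integrable lborel (\<lambda>x. F (inverse (sqrt 2) *\<^sub>R x) * G (inverse (sqrt 2) *\<^sub>R x))"
      using integrable_lborel_affine[OF _ FG, of "inverse (sqrt 2)" 0] by simp
    have "integrable lborel P'"
    proof -
      have "integrable lborel (\<lambda>x. chirp (- a) (- d) x * (chirp a d x * P' x))"
        unfolding chirp_P' by (rule integrable_unimodular_mult[OF FG_scaled]) simp_all
      moreover have "chirp (- a) (- d) x * (chirp a d x * P' x) = P' x" for x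
        using chirp_inverse[of a d x] by algebra
      ultimately show ?thesis by simp
    qed
    then show "integrable lebesgue
            (\<lambda>x. exp (\<i> * (\<Sum>k\<in>UNIV. complex_of_real ((sqrt 2 - 1) * d $ k * x $ k))) *
                 f (x /\<^sub>R sqrt 2) * g (x /\<^sub>R sqrt 2))"
      using lebesgue_cong_borel(1)[OF P'_m P_ae] unfolding P_def[abs_def] w_def[abs_def] by simp

    define K where "K = qp_const b"
    define K' where "K' = (\<Prod>k\<in>UNIV. csqrt (\<i> * complex_of_real (b $ k) / complex_of_real pi))"
    define B where "B = complex_of_real (\<Prod>k\<in>UNIV. \<bar>b $ k\<bar>)"
    define T where "T = complex_of_real (sqrt 2) ^ CARD('n)"
    define \<Phi> where "\<Phi> = fourier (\<lambda>x. F x * G x) (sqrt 2 *\<^sub>R diag_scale b \<omega>)"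
    \<comment> \<open>the change of variables \<open>D\<close> puts the factor \<open>B\<close> on the side of \<open>\<ominus>\<close>; it is cancelled at the end\<close>
    have B0: "B \<noteq> 0" using b by (simp add: B_def)
    have const: "K' * K * (2 * pi) ^ CARD('n) = T * B"
      using dual_const_eq[OF b] by (simp add: K_def K'_def B_def T_def)
    have left: "qpft a b c d e P \<omega> = K * chirp c e \<omega> * (T * \<Phi>)"
    proof -
      have "inverse (sqrt 2) ^ CARD('n) * fourier (\<lambda>x. chirp a d x * P' x) (diag_scale b \<omega>) = \<Phi>"
        using fourier_scale[of "\<lambda>x. F x * G x" "inverse (sqrt 2)" "diag_scale b \<omega>"]
        by (simp add: chirp_P' \<Phi>_def)
      then have "fourier (\<lambda>x. chirp a d x * P' x) (diag_scale b \<omega>) = T * \<Phi>"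
        by (auto simp: T_def field_simps)
      then show ?thesis
        by (simp add: qpft_eq_fourier[OF P'_m P_ae] K_def)
    qed
    have right: "B * qp_dual_conv b c e (qpft a b c d e f) (qpft a b c d e g) \<omega> =
        K' * chirp c e \<omega> * (K * K * ((2 * pi) ^ CARD('n) * \<Phi>))"
    proof -
      define \<eta> where "\<eta> = sqrt 2 *\<^sub>R \<omega>"
      have "qp_dual_conv b c e (qpft a b c d e f) (qpft a b c d e g) \<omega> =
         K' * (chirp c e \<omega> * conv_fun (\<lambda>\<tau>. K * fourier F (diag_scale b \<tau>))
           (\<lambda>\<tau>. K * fourier G (diag_scale b \<tau>)) \<eta>)"
        unfolding qp_dual_conv_eq[OF Qf_m Qg_m AE_I2 AE_I2, OF refl refl] dechirp_f dechirp_g K'_def K_def \<eta>_def ..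
      also have "conv_fun (\<lambda>\<tau>. K * fourier F (diag_scale b \<tau>)) (\<lambda>\<tau>. K * fourier G (diag_scale b \<tau>)) \<eta> =
         K * K * (LINT \<tau>|lborel. fourier F (diag_scale b \<tau>) * fourier G (diag_scale b \<eta> - diag_scale b \<tau>))"
        unfolding conv_fun_def diag_scale_diff
        by (subst integral_mult_right_zero[symmetric]) (simp only: mult_ac)
      finally have 1: "qp_dual_conv b c e (qpft a b c d e f) (qpft a b c d e g) \<omega> =
         K' * chirp c e \<omega> * (K * K * (LINT \<tau>|lborel. fourier F (diag_scale b \<tau>) * fourier G (diag_scale b \<eta> - diag_scale b \<tau>)))"
        by (simp only: mult.assoc)
      have "B * (LINT \<tau>|lborel. fourier F (diag_scale b \<tau>) * fourier G (diag_scale b \<eta> - diag_scale b \<tau>)) =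
         conv_fun (fourier F) (fourier G) (diag_scale b \<eta>)"
        unfolding conv_fun_def
        by (subst integral_diag_scale[OF b]) (simp_all add: B_def scaleR_conv_of_real)
      also have "\<dots> = (2 * pi) ^ CARD('n) * \<Phi>"
        unfolding conv_fun_fourier[OF F G FF] by (simp add: \<Phi>_def \<eta>_def diag_scale_scaleR)
      finally have 2: "(2 * pi) ^ CARD('n) * \<Phi> =
        B * (LINT \<tau>|lborel. fourier F (diag_scale b \<tau>) * fourier G (diag_scale b \<eta> - diag_scale b \<tau>))"
        by (rule sym)
      show ?thesis unfolding 1 2 by (simp only: mult_ac)
    qed
    have "B * qpft a b c d e P \<omega> = B * qp_dual_conv b c e (qpft a b c d e f) (qpft a b c d e g) \<omega>"
      unfolding left right using const by algebra
    then show "qpft a b c d e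
             (\<lambda>x. exp (\<i> * (\<Sum>k\<in>UNIV. complex_of_real ((sqrt 2 - 1) * d $ k * x $ k))) *
                  f (x /\<^sub>R sqrt 2) * g (x /\<^sub>R sqrt 2)) \<omega> =
             qp_dual_conv b c e (qpft a b c d e f) (qpft a b c d e g) \<omega>"
      using B0 unfolding P_def[abs_def] w_def[abs_def] by simp
  qed
  show ?thesis using first second by blast
qed

end
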